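(* Let $A$ be a commutative $\Bbbk$-algebra, let $M$ be an $A$-module and let $(A,L,\omega)$ be a Lie-Rinehart algebra. The Lie-Rinehart algebra $(A,\mathrm{DO}(A,L,M),\tilde\omega)$ is the product in the category $\mathsf{LieRin}_A$ of the Lie-Rinehart algebras $(A,L,\omega)$ and $\mathcal{L}_A(\mathrm{End}_\Bbbk(M))$.
   Context: $\Bbbk$ is a field of characteristic $0$. A Lie-Rinehart algebra $(A,L,\omega)$ over a commutative $\Bbbk$-algebra $A$ is a $\Bbbk$-Lie algebra $L$ with a left $A$-module structure and a Lie algebra morphism $\omega:L\to\mathrm{Der}_\Bbbk(A)$ (the anchor) such that $\omega(a\cdot X)=a\cdot\omega(X)$ and $[X,a\cdot Y]=a\cdot[X,Y]+\omega(X)(a)\cdot Y$ for all $a\in A$, $X,Y\in L$. A morphism over $A$ from $(L,\omega)$ to $(L',\omega')$ is an $A$-linear Lie algebra morphism $f$ with $\omega'\circ f=\omega$. The category of Lie-Rinehart algebras over $A$ and these morphisms is $\mathsf{LieRin}_A$. $\mathrm{DO}(A,L,M)$ (infinitesimal gauge transformations of $M$ with respect to $L$) is the subspace of $\mathrm{End}_\Bbbk(M)\times L$ of all $(f,X)$ such that $f(a\cdot m)=\omega(X)(a)\cdot m+a\cdot f(m)$ for all $a\in A$, $m\in M$, with component-wise bracket and $A$-action ($(a\cdot f)(m)=a\cdot f(m)$) and anchor $\tilde\omega(f,X)=\omega(X)$. For a $\Bbbk$-algebra $R$ with a $\Bbbk$-algebra map $\phi:A\to R$, $\mathcal{L}_A(R)=\{(r,\delta)\in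 R\times\mathrm{Der}_\Bbbk(A)\mid[r,\phi(a)]=\phi(\delta(a))\ \forall a\in A\}$, a Lie-Rinehart algebra over $A$ with component-wise bracket, action $a\cdot(r,\delta)=(\phi(a)r,a\cdot\delta)$ and anchor $(r,\delta)\mapsto\delta$. Here $R=\mathrm{End}_\Bbbk(M)$ with $\phi(a)=l_a$, $l_a(m)=a\cdot m$. *)

theory Defs
  imports "HOL-Algebra.Module"
begin

(* Lie algebras are modules with a bracket; the ring operations mult and one, which every
   record of type module inherits, play no role in them and are left undefined in the
   constructions below.  All functions that serve as elements or as morphisms are extensional,
   so that equality of maps is HOL equality. *)

record ('a, 'l) lie_module = "('a, 'l) module" +
  bracket :: "['l, 'l] \<Rightarrow> 'l"

record ('a, 'l) lie_rinehart = "('a, 'l) lie_module" +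
  anchor :: "'l \<Rightarrow> 'a \<Rightarrow> 'a"

definition char_zero :: "('k, 'z) ring_scheme \<Rightarrow> bool" where
  "char_zero k \<longleftrightarrow> (\<forall>n::nat. n > 0 \<longrightarrow> [n] \<cdot>\<^bsub>k\<^esub> \<one>\<^bsub>k\<^esub> \<noteq> \<zero>\<^bsub>k\<^esub>)"

definition lin_maps ::
  "('k, 'r) ring_scheme \<Rightarrow> ('k, 'm, 'x) module_scheme \<Rightarrow> ('k, 'n, 'y) module_scheme \<Rightarrow> ('m \<Rightarrow> 'n) set"
  where
  "lin_maps k M N = {f \<in> carrier M \<rightarrow> carrier N.
     (\<forall>x\<in>carrier M. \<forall>y\<in>carrier M. f (x \<oplus>\<^bsub>M\<^esub> y) = f x \<oplus>\<^bsub>N\<^esub> f y) \<and>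
     (\<forall>c\<in>carrier k. \<forall>x\<in>carrier M. f (c \<odot>\<^bsub>M\<^esub> x) = c \<odot>\<^bsub>N\<^esub> f x)}"

locale lie_algebra = module k L
  for k :: "('k, 'r) ring_scheme" (structure) and L :: "('k, 'l, 'x) lie_module_scheme" (structure) +
  assumes bracket_closed:
      "\<lbrakk>x \<in> carrier L; y \<in> carrier L\<rbrakk> \<Longrightarrow> bracket L x y \<in> carrier L"
    and bracket_add_left:
      "\<lbrakk>x \<in> carrier L; y \<in> carrier L; z \<in> carrier L\<rbrakk> \<Longrightarrow>
        bracket L (x \<oplus>\<^bsub>L\<^esub> y) z = bracket L x z \<oplus>\<^bsub>L\<^esub> bracket L y z"
    and bracket_add_right:
      "\<lbrakk>x \<in> carrier L; y \<in> carrier L; z \<in> carrier L\<rbrakk> \<Longrightarrow>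
        bracket L x (y \<oplus>\<^bsub>L\<^esub> z) = bracket L x y \<oplus>\<^bsub>L\<^esub> bracket L x z"
    and bracket_smult_left:
      "\<lbrakk>c \<in> carrier k; x \<in> carrier L; y \<in> carrier L\<rbrakk> \<Longrightarrow>
        bracket L (c \<odot>\<^bsub>L\<^esub> x) y = c \<odot>\<^bsub>L\<^esub> bracket L x y"
    and bracket_smult_right:
      "\<lbrakk>c \<in> carrier k; x \<in> carrier L; y \<in> carrier L\<rbrakk> \<Longrightarrow>
        bracket L x (c \<odot>\<^bsub>L\<^esub> y) = c \<odot>\<^bsub>L\<^esub> bracket L x y"
    and bracket_self:
      "x \<in> carrier L \<Longrightarrow> bracket L x x = \<zero>\<^bsub>L\<^esub>"
    and jacobi:
      "\<lbrakk>x \<in> carrier L; y \<in> carrier L; z \<in> carrier L\<rbrakk> \<Longrightarrow>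
        bracket L x (bracket L y z) \<oplus>\<^bsub>L\<^esub> bracket L y (bracket L z x)
          \<oplus>\<^bsub>L\<^esub> bracket L z (bracket L x y) = \<zero>\<^bsub>L\<^esub>"

definition lie_hom ::
  "('k, 'r) ring_scheme \<Rightarrow> ('k, 'l, 'x) lie_module_scheme \<Rightarrow> ('k, 'n, 'y) lie_module_scheme
    \<Rightarrow> ('l \<Rightarrow> 'n) set" where
  "lie_hom k L N = {f \<in> lin_maps k L N.
     \<forall>x\<in>carrier L. \<forall>y\<in>carrier L. f (bracket L x y) = bracket N (f x) (f y)}"

(* The k-module underlying an A-module M, where A is a k-algebra: c acts as c 1_A. *)

definition restrict_scalars ::
  "('k, 'a, 'x) module_scheme \<Rightarrow> ('a, 'm, 'y) module_scheme \<Rightarrow> ('k, 'm) module" where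
  "restrict_scalars A M =
     \<lparr>carrier = carrier M, mult = mult M, one = one M, zero = zero M, add = add M,
      smult = (\<lambda>c x. (c \<odot>\<^bsub>A\<^esub> \<one>\<^bsub>A\<^esub>) \<odot>\<^bsub>M\<^esub> x)\<rparr>"

definition restrict_lie ::
  "('k, 'a, 'x) module_scheme \<Rightarrow> ('a, 'l, 'y) lie_module_scheme \<Rightarrow> ('k, 'l) lie_module" where
  "restrict_lie A L =
     \<lparr>carrier = carrier L, mult = mult L, one = one L, zero = zero L, add = add L,
      smult = (\<lambda>c x. (c \<odot>\<^bsub>A\<^esub> \<one>\<^bsub>A\<^esub>) \<odot>\<^bsub>L\<^esub> x), bracket = bracket L\<rparr>"

definition Der ::
  "('k, 'r) ring_scheme \<Rightarrow> ('k, 'a, 'x) module_scheme \<Rightarrow> ('a, 'a \<Rightarrow> 'a) lie_module" where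
  "Der k A =
     \<lparr>carrier = {D \<in> lin_maps k A A \<inter> extensional (carrier A).
         \<forall>a\<in>carrier A. \<forall>b\<in>carrier A. D (a \<otimes>\<^bsub>A\<^esub> b) = a \<otimes>\<^bsub>A\<^esub> D b \<oplus>\<^bsub>A\<^esub> D a \<otimes>\<^bsub>A\<^esub> b},
      mult = undefined, one = undefined,
      zero = (\<lambda>a\<in>carrier A. \<zero>\<^bsub>A\<^esub>),
      add = (\<lambda>D E. \<lambda>a\<in>carrier A. D a \<oplus>\<^bsub>A\<^esub> E a),
      smult = (\<lambda>c D. \<lambda>a\<in>carrier A. c \<otimes>\<^bsub>A\<^esub> D a),
      bracket = (\<lambda>D E. \<lambda>a\<in>carrier A. D (E a) \<ominus>\<^bsub>A\<^esub> E (D a))\<rparr>"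

(* The k-vector space structure of L is the one induced by its A-module structure. *)

locale lie_rinehart =
  fixes k :: "('k, 'r) ring_scheme" and A :: "('k, 'a, 'x) module_scheme"
    and L :: "('a, 'l, 'y) lie_rinehart_scheme"
  assumes base_algebra: "algebra k A"
    and module_over_base: "module A L"
    and lie_algebra: "lie_algebra k (restrict_lie A L)"
    and anchor_lie_hom: "anchor L \<in> lie_hom k (restrict_lie A L) (restrict_lie A (Der k A))"
    and anchor_smult: "\<lbrakk>a \<in> carrier A; X \<in> carrier L\<rbrakk> \<Longrightarrow>
        anchor L (a \<odot>\<^bsub>L\<^esub> X) = a \<odot>\<^bsub>Der k A\<^esub> anchor L X"
    and leibniz: "\<lbrakk>a \<in> carrier A; X \<in> carrier L; Y \<in> carrier L\<rbrakk> \<Longrightarrow>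
        bracket L X (a \<odot>\<^bsub>L\<^esub> Y) = a \<odot>\<^bsub>L\<^esub> bracket L X Y \<oplus>\<^bsub>L\<^esub> anchor L X a \<odot>\<^bsub>L\<^esub> Y"

(* The morphisms of LieRin_A; their composition is compose from FuncSet. *)

definition lie_rinehart_hom ::
  "('k, 'r) ring_scheme \<Rightarrow> ('k, 'a, 'x) module_scheme \<Rightarrow> ('a, 'l, 'y) lie_rinehart_scheme
    \<Rightarrow> ('a, 'n, 'z) lie_rinehart_scheme \<Rightarrow> ('l \<Rightarrow> 'n) set" where
  "lie_rinehart_hom k A L N = {f \<in> extensional (carrier L).
     f \<in> lin_maps A L N \<and>
     f \<in> lie_hom k (restrict_lie A L) (restrict_lie A N) \<and>
     (\<forall>X\<in>carrier L. anchor N (f X) = anchor L X)}"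

(* P with projections p and q is a product of L1 and L2 in LieRin_A.  HOL cannot quantify over
   types inside a formula, so the type of the elements of the test objects N is an argument. *)

definition is_LieRin_product ::
  "'n itself \<Rightarrow> ('k, 'r) ring_scheme \<Rightarrow> ('k, 'a, 'x) module_scheme \<Rightarrow> ('a, 'p) lie_rinehart
    \<Rightarrow> ('p \<Rightarrow> 'l) \<Rightarrow> ('p \<Rightarrow> 'm) \<Rightarrow> ('a, 'l) lie_rinehart \<Rightarrow> ('a, 'm) lie_rinehart \<Rightarrow> bool" where
  "is_LieRin_product (_ :: 'n itself) k A P p q L1 L2 \<longleftrightarrow>
     lie_rinehart k A P \<and> lie_rinehart k A L1 \<and> lie_rinehart k A L2 \<and>
     p \<in> lie_rinehart_hom k A P L1 \<and> q \<in> lie_rinehart_hom k A P L2 \<and>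
     (\<forall>(N :: ('a, 'n) lie_rinehart) f g.
        lie_rinehart k A N \<longrightarrow> f \<in> lie_rinehart_hom k A N L1 \<longrightarrow> g \<in> lie_rinehart_hom k A N L2 \<longrightarrow>
        (\<exists>!h. h \<in> lie_rinehart_hom k A N P \<and>
              compose (carrier N) p h = f \<and> compose (carrier N) q h = g))"

definition End_alg ::
  "('k, 'r) ring_scheme \<Rightarrow> ('k, 'm, 'x) module_scheme \<Rightarrow> ('k, 'm \<Rightarrow> 'm) module" where
  "End_alg k M =
     \<lparr>carrier = lin_maps k M M \<inter> extensional (carrier M),
      mult = (\<lambda>f g. compose (carrier M) f g),
      one = (\<lambda>m\<in>carrier M. m),
      zero = (\<lambda>m\<in>carrier M. \<zero>\<^bsub>M\<^esub>),
      add = (\<lambda>f g. \<lambda>m\<in>carrier M. f m \<oplus>\<^bsub>M\<^esub> g m),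
      smult = (\<lambda>c f. \<lambda>m\<in>carrier M. c \<odot>\<^bsub>M\<^esub> f m)\<rparr>"

definition left_mult :: "('a, 'm, 'x) module_scheme \<Rightarrow> 'a \<Rightarrow> 'm \<Rightarrow> 'm" where
  "left_mult M a = (\<lambda>m\<in>carrier M. a \<odot>\<^bsub>M\<^esub> m)"

definition commutator :: "('r, 'x) ring_scheme \<Rightarrow> 'r \<Rightarrow> 'r \<Rightarrow> 'r" where
  "commutator R r s = (r \<otimes>\<^bsub>R\<^esub> s) \<ominus>\<^bsub>R\<^esub> (s \<otimes>\<^bsub>R\<^esub> r)"

(* The Lie-Rinehart algebra L_A(R) of a k-algebra R with a k-algebra map phi from A to R. *)

definition LR_of_algebra ::
  "('k, 'z) ring_scheme \<Rightarrow> ('k, 'a, 'x) module_scheme \<Rightarrow> ('k, 'r, 'y) module_scheme \<Rightarrow> ('a \<Rightarrow> 'r)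
    \<Rightarrow> ('a, 'r \<times> ('a \<Rightarrow> 'a)) lie_rinehart" where
  "LR_of_algebra k A R \<phi> =
     \<lparr>carrier = {(r, \<delta>). r \<in> carrier R \<and> \<delta> \<in> carrier (Der k A) \<and>
         (\<forall>a\<in>carrier A. commutator R r (\<phi> a) = \<phi> (\<delta> a))},
      mult = undefined, one = undefined,
      zero = (\<zero>\<^bsub>R\<^esub>, \<zero>\<^bsub>Der k A\<^esub>),
      add = (\<lambda>(r, \<delta>) (s, \<epsilon>). (r \<oplus>\<^bsub>R\<^esub> s, \<delta> \<oplus>\<^bsub>Der k A\<^esub> \<epsilon>)),
      smult = (\<lambda>a (r, \<delta>). (\<phi> a \<otimes>\<^bsub>R\<^esub> r, a \<odot>\<^bsub>Der k A\<^esub> \<delta>)),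
      bracket = (\<lambda>(r, \<delta>) (s, \<epsilon>). (commutator R r s, bracket (Der k A) \<delta> \<epsilon>)),
      anchor = (\<lambda>(r, \<delta>). \<delta>)\<rparr>"

definition DO ::
  "('k, 'z) ring_scheme \<Rightarrow> ('k, 'a, 'x) module_scheme \<Rightarrow> ('a, 'l, 'y) lie_rinehart_scheme
    \<Rightarrow> ('a, 'm, 'w) module_scheme \<Rightarrow> ('a, ('m \<Rightarrow> 'm) \<times> 'l) lie_rinehart" where
  "DO k A L M = (let E = End_alg k (restrict_scalars A M) in
     \<lparr>carrier = {(f, X). f \<in> carrier E \<and> X \<in> carrier L \<and>
         (\<forall>a\<in>carrier A. \<forall>m\<in>carrier M. f (a \<odot>\<^bsub>M\<^esub> m) = anchor L X a \<odot>\<^bsub>M\<^esub> m \<oplus>\<^bsub>M\<^esub> a \<odot>\<^bsub>M\<^esub> f m)},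
      mult = undefined, one = undefined,
      zero = (\<zero>\<^bsub>E\<^esub>, \<zero>\<^bsub>L\<^esub>),
      add = (\<lambda>(f, X) (g, Y). (f \<oplus>\<^bsub>E\<^esub> g, X \<oplus>\<^bsub>L\<^esub> Y)),
      smult = (\<lambda>a (f, X). (\<lambda>m\<in>carrier M. a \<odot>\<^bsub>M\<^esub> f m, a \<odot>\<^bsub>L\<^esub> X)),
      bracket = (\<lambda>(f, X) (g, Y). (commutator E f g, bracket L X Y)),
      anchor = (\<lambda>(f, X). anchor L X)\<rparr>)"

definition DO_proj_L ::
  "('k, 'z) ring_scheme \<Rightarrow> ('k, 'a, 'x) module_scheme \<Rightarrow> ('a, 'l, 'y) lie_rinehart_scheme
    \<Rightarrow> ('a, 'm, 'w) module_scheme \<Rightarrow> ('m \<Rightarrow> 'm) \<times> 'l \<Rightarrow> 'l" where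
  "DO_proj_L k A L M = (\<lambda>(f, X)\<in>carrier (DO k A L M). X)"

definition DO_proj_End ::
  "('k, 'z) ring_scheme \<Rightarrow> ('k, 'a, 'x) module_scheme \<Rightarrow> ('a, 'l, 'y) lie_rinehart_scheme
    \<Rightarrow> ('a, 'm, 'w) module_scheme \<Rightarrow> ('m \<Rightarrow> 'm) \<times> 'l \<Rightarrow> ('m \<Rightarrow> 'm) \<times> ('a \<Rightarrow> 'a)" where
  "DO_proj_End k A L M = (\<lambda>(f, X)\<in>carrier (DO k A L M). (f, anchor L X))"

end

(* A morphism h into DO(A, L, M) is a pair (f, g') with f a morphism into L and g' taking values in
   End(M); the condition defining DO says precisely that X |-> (g' X, omega (f X)) lands in
   L_A(End(M)).  As morphisms of Lie-Rinehart algebras preserve anchors, every morphism into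
   L_A(End(M)) has this form, so pairs of morphisms into the two factors correspond to morphisms
   into DO(A, L, M).  That L_A(End(M)) is itself a Lie-Rinehart algebra is the case L = Der(A) of
   the same fact for DO(A, L, M). *)

theory Submission
  imports Defs
begin

section \<open>Commutators\<close>

text \<open>Der(A), anchored by the identity, is terminal in the category: a morphism into it has to
  be the anchor of its source. A product in LieRin_A is therefore a fibre product over Der(A), and
  DO(A, L, M) is this fibre product with the determined coordinate omega(X) dropped; hence the
  second projection (f, X) |-> (f, omega(X)). The weight of the proof lies in showing that DO(A, L,
  M) is an object at all. An element f is not A-linear, so f(g(a m)) produces the mixed terms
  omega(X)(a) g(m) and omega(Y)(a) f(m); the same two terms occur in g(f(a m)), and they cancel in
  the commutator. A further obstacle is that End_k(M) is built over
  \<open>restrict_scalars A M\<close>, whereas the condition on f lives in the A-module M. The two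
  records share carrier, addition and zero, and bridging lemmas carry module laws and subtraction
  from one to the other.\<close>

context abelian_group
begin

lemma minus_add_minus:
  assumes "x \<in> carrier G" "y \<in> carrier G" "u \<in> carrier G" "v \<in> carrier G"
  shows "(x \<oplus> u) \<ominus> (y \<oplus> v) = (x \<ominus> y) \<oplus> (u \<ominus> v)"
  using assms by (simp add: minus_eq minus_add a_ac)

text \<open>Serves to turn the commutator condition of \<open>LR_of_algebra\<close>, a statement
  about a difference, into the additive condition of \<open>DO\<close>.\<close>

lemma minus_eq_iff:
  "\<lbrakk>x \<in> carrier G; y \<in> carrier G; z \<in> carrier G\<rbrakk> \<Longrightarrow> x \<ominus> y = z \<longleftrightarrow> x = z \<oplus> y"
  by (auto simp: minus_eq a_assoc l_neg r_neg)

lemma minus_self: "x \<in> carrier G \<Longrightarrow> x \<ominus> x = \<zero>"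
  by (simp add: minus_eq r_neg)

end

context ring
begin

lemma commutator_closed:
  "\<lbrakk>x \<in> carrier R; y \<in> carrier R\<rbrakk> \<Longrightarrow> commutator R x y \<in> carrier R"
  by (simp add: commutator_def)

lemma commutator_add_left:
  "\<lbrakk>x \<in> carrier R; y \<in> carrier R; z \<in> carrier R\<rbrakk> \<Longrightarrow>
    commutator R (x \<oplus> y) z = commutator R x z \<oplus> commutator R y z"
  by (simp add: commutator_def l_distr r_distr minus_add_minus)

lemma commutator_add_right:
  "\<lbrakk>x \<in> carrier R; y \<in> carrier R; z \<in> carrier R\<rbrakk> \<Longrightarrow>
    commutator R x (y \<oplus> z) = commutator R x y \<oplus> commutator R x z"
  by (simp add: commutator_def l_distr r_distr minus_add_minus)

lemma commutator_self: "x \<in> carrier R \<Longrightarrow> commutator R x x = \<zero>"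
  by (simp add: commutator_def minus_self)

text \<open>Expansion gives twelve words in x, y, z: each of the six orderings occurs once with
  either sign, by associativity.\<close>

lemma commutator_jacobi:
  assumes "x \<in> carrier R" "y \<in> carrier R" "z \<in> carrier R"
  shows "commutator R x (commutator R y z) \<oplus> commutator R y (commutator R z x)
    \<oplus> commutator R z (commutator R x y) = \<zero>"
  unfolding commutator_def using assms by algebra

end

section \<open>Endomorphisms and restriction of scalars\<close>

lemma carrier_End_alg_iff:
  "f \<in> carrier (End_alg k M) \<longleftrightarrow> f \<in> carrier M \<rightarrow> carrier M \<and> f \<in> extensional (carrier M) \<and>
    (\<forall>x\<in>carrier M. \<forall>y\<in>carrier M. f (x \<oplus>\<^bsub>M\<^esub> y) = f x \<oplus>\<^bsub>M\<^esub> f y) \<and>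
    (\<forall>c\<in>carrier k. \<forall>x\<in>carrier M. f (c \<odot>\<^bsub>M\<^esub> x) = c \<odot>\<^bsub>M\<^esub> f x)"
  by (auto simp: End_alg_def lin_maps_def)

lemma End_alg_closed: "\<lbrakk>f \<in> carrier (End_alg k M); m \<in> carrier M\<rbrakk> \<Longrightarrow> f m \<in> carrier M"
  by (auto simp: carrier_End_alg_iff)

lemma End_alg_add:
  "\<lbrakk>f \<in> carrier (End_alg k M); x \<in> carrier M; y \<in> carrier M\<rbrakk> \<Longrightarrow>
    f (x \<oplus>\<^bsub>M\<^esub> y) = f x \<oplus>\<^bsub>M\<^esub> f y"
  by (auto simp: carrier_End_alg_iff)

lemma End_alg_simps:
  "\<zero>\<^bsub>End_alg k M\<^esub> = (\<lambda>m\<in>carrier M. \<zero>\<^bsub>M\<^esub>)"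
  "\<one>\<^bsub>End_alg k M\<^esub> = (\<lambda>m\<in>carrier M. m)"
  "f \<oplus>\<^bsub>End_alg k M\<^esub> g = (\<lambda>m\<in>carrier M. f m \<oplus>\<^bsub>M\<^esub> g m)"
  "f \<otimes>\<^bsub>End_alg k M\<^esub> g = compose (carrier M) f g"
  "c \<odot>\<^bsub>End_alg k M\<^esub> f = (\<lambda>m\<in>carrier M. c \<odot>\<^bsub>M\<^esub> f m)"
  by (simp_all add: End_alg_def)

context module
begin

text \<open>Commutativity of the base ring enters here. With one factor of the form c 1_A it shows
  that l_a, and a f for k-linear f, are again k-linear.\<close>

lemma smult_left_commute:
  "\<lbrakk>a \<in> carrier R; b \<in> carrier R; x \<in> carrier M\<rbrakk> \<Longrightarrow>
    a \<odot>\<^bsub>M\<^esub> (b \<odot>\<^bsub>M\<^esub> x) = b \<odot>\<^bsub>M\<^esub> (a \<odot>\<^bsub>M\<^esub> x)"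
  by (simp add: smult_assoc1[symmetric] R.m_comm)

lemma smult_r_diff:
  "\<lbrakk>a \<in> carrier R; x \<in> carrier M; y \<in> carrier M\<rbrakk> \<Longrightarrow>
    a \<odot>\<^bsub>M\<^esub> (x \<ominus>\<^bsub>M\<^esub> y) = a \<odot>\<^bsub>M\<^esub> x \<ominus>\<^bsub>M\<^esub> a \<odot>\<^bsub>M\<^esub> y"
  by (simp add: M.minus_eq smult_r_distr smult_r_minus)

lemma smult_l_diff:
  "\<lbrakk>a \<in> carrier R; b \<in> carrier R; x \<in> carrier M\<rbrakk> \<Longrightarrow>
    (a \<ominus> b) \<odot>\<^bsub>M\<^esub> x = a \<odot>\<^bsub>M\<^esub> x \<ominus>\<^bsub>M\<^esub> b \<odot>\<^bsub>M\<^esub> x"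
  by (simp add: a_minus_def smult_l_distr smult_l_minus)

lemma End_alg_minus_closed:
  "f \<in> carrier (End_alg R M) \<Longrightarrow> (\<lambda>m\<in>carrier M. \<ominus>\<^bsub>M\<^esub> f m) \<in> carrier (End_alg R M)"
  by (auto simp: carrier_End_alg_iff M.minus_add smult_r_minus Pi_iff)

lemma End_alg_abelian_group: "abelian_group (End_alg R M)"
proof (rule abelian_groupI)
  fix f g h
  assume f: "f \<in> carrier (End_alg R M)" and g: "g \<in> carrier (End_alg R M)"
    and h: "h \<in> carrier (End_alg R M)"
  note cl = End_alg_closed[OF f] End_alg_closed[OF g] End_alg_closed[OF h]
  show "f \<oplus>\<^bsub>End_alg R M\<^esub> g \<in> carrier (End_alg R M)"
    using f g by (auto simp: End_alg_simps carrier_End_alg_iff Pi_iff M.a_ac smult_r_distr)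
  show "f \<oplus>\<^bsub>End_alg R M\<^esub> g \<oplus>\<^bsub>End_alg R M\<^esub> h = f \<oplus>\<^bsub>End_alg R M\<^esub> (g \<oplus>\<^bsub>End_alg R M\<^esub> h)"
    using cl by (auto simp: End_alg_simps M.a_assoc)
  show "f \<oplus>\<^bsub>End_alg R M\<^esub> g = g \<oplus>\<^bsub>End_alg R M\<^esub> f"
    using cl by (auto simp: End_alg_simps M.a_comm)
  show "\<zero>\<^bsub>End_alg R M\<^esub> \<oplus>\<^bsub>End_alg R M\<^esub> f = f"
    using f cl by (auto simp: End_alg_simps carrier_End_alg_iff extensional_def)
  show "\<exists>h\<in>carrier (End_alg R M). h \<oplus>\<^bsub>End_alg R M\<^esub> f = \<zero>\<^bsub>End_alg R M\<^esub>"
    using cl by (intro bexI[OF _ End_alg_minus_closed[OF f]]) (auto simp: End_alg_simps M.l_neg)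
qed (auto simp: End_alg_simps carrier_End_alg_iff)

lemma End_alg_ring: "ring (End_alg R M)"
proof (rule ringI[OF End_alg_abelian_group])
  show "monoid (End_alg R M)"
  proof (rule monoidI)
    fix f g h
    assume fgh: "f \<in> carrier (End_alg R M)" "g \<in> carrier (End_alg R M)" "h \<in> carrier (End_alg R M)"
    then show "f \<otimes>\<^bsub>End_alg R M\<^esub> g \<in> carrier (End_alg R M)"
      by (auto simp: End_alg_simps carrier_End_alg_iff Pi_iff compose_def)
    show "f \<otimes>\<^bsub>End_alg R M\<^esub> g \<otimes>\<^bsub>End_alg R M\<^esub> h = f \<otimes>\<^bsub>End_alg R M\<^esub> (g \<otimes>\<^bsub>End_alg R M\<^esub> h)"
      using fgh by (auto simp: End_alg_simps compose_def End_alg_closed)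
    show "\<one>\<^bsub>End_alg R M\<^esub> \<otimes>\<^bsub>End_alg R M\<^esub> f = f" "f \<otimes>\<^bsub>End_alg R M\<^esub> \<one>\<^bsub>End_alg R M\<^esub> = f"
      using fgh by (auto simp: End_alg_simps carrier_End_alg_iff compose_def
          intro!: extensionalityI[of _ "carrier M"])
  qed (auto simp: End_alg_simps carrier_End_alg_iff)
qed (auto simp: End_alg_simps compose_def End_alg_closed End_alg_add)

lemma commutator_End_alg_apply:
  assumes f: "f \<in> carrier (End_alg R M)" and g: "g \<in> carrier (End_alg R M)"
    and m: "m \<in> carrier M"
  shows "commutator (End_alg R M) f g m = f (g m) \<ominus>\<^bsub>M\<^esub> g (f m)"
proof -
  interpret E: ring "End_alg R M" by (rule End_alg_ring)
  \<comment> \<open>Negation in \<open>End_alg\<close> is the inverse picked out by description in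
    the additive group; uniqueness of inverses identifies it with pointwise negation.\<close>
  have neg: "\<ominus>\<^bsub>End_alg R M\<^esub> h = (\<lambda>m\<in>carrier M. \<ominus>\<^bsub>M\<^esub> h m)" if h: "h \<in> carrier (End_alg R M)" for h
    using h by (intro E.minus_equality End_alg_minus_closed)
      (auto simp: End_alg_simps M.l_neg End_alg_closed)
  have "g \<otimes>\<^bsub>End_alg R M\<^esub> f \<in> carrier (End_alg R M)"
    using f g by simp
  with m show ?thesis
    by (simp add: commutator_def E.minus_eq neg) (simp add: End_alg_simps compose_def M.minus_eq)
qed

end

text \<open>The module axioms see only carrier, zero, addition and the action on carriers. This
  transports them between records of different types, and between actions that disagree on junk
  values.\<close>

lemma module_cong:
  fixes M :: "('a, 'm, 'x) module_scheme" and N :: "('a, 'm, 'y) module_scheme"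
  assumes M: "module R M"
    and eq: "carrier N = carrier M" "\<zero>\<^bsub>N\<^esub> = \<zero>\<^bsub>M\<^esub>" "add N = add M"
    and smult_eq: "\<And>a x. \<lbrakk>a \<in> carrier R; x \<in> carrier M\<rbrakk> \<Longrightarrow> a \<odot>\<^bsub>N\<^esub> x = a \<odot>\<^bsub>M\<^esub> x"
  shows "module R N"
proof -
  interpret module R M by (rule M)
  show ?thesis
    by (rule moduleI)
      (auto simp: eq smult_eq smult_l_distr smult_r_distr smult_assoc1 M.a_ac
        intro!: R.is_cring abelian_groupI bexI[of _ "\<ominus>\<^bsub>M\<^esub> x" for x] M.l_neg)
qed

lemma module_restrict_scalars:
  assumes A: "algebra k A" and M: "module A M"
  shows "module k (restrict_scalars A M)"
proof -
  interpret A: algebra k A by (rule A)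
  interpret M: module A M by (rule M)
  \<comment> \<open>The map c |-> c 1_A is multiplicative, which is what associativity of the
    restricted action amounts to.\<close>
  have mult: "(c \<otimes>\<^bsub>k\<^esub> d) \<odot>\<^bsub>A\<^esub> \<one>\<^bsub>A\<^esub> = (c \<odot>\<^bsub>A\<^esub> \<one>\<^bsub>A\<^esub>) \<otimes>\<^bsub>A\<^esub> (d \<odot>\<^bsub>A\<^esub> \<one>\<^bsub>A\<^esub>)"
    if "c \<in> carrier k" "d \<in> carrier k" for c d
    using that by (simp add: A.smult_assoc1 A.smult_assoc2)
  show ?thesis
    by (rule moduleI)
      (auto simp: restrict_scalars_def A.smult_l_distr M.smult_l_distr M.smult_r_distr
        mult M.smult_assoc1 M.M.a_ac
        intro!: A.R_cring abelian_groupI bexI[of _ "\<ominus>\<^bsub>M\<^esub> x" for x] M.M.l_neg)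
qed

section \<open>Constructing Lie-Rinehart algebras\<close>

text \<open>Viewing derivations inside End_k(A) lets them inherit the additive laws and the Jacobi
  identity from a ring.\<close>

lemma carrier_Der_iff:
  "D \<in> carrier (Der k A) \<longleftrightarrow> D \<in> carrier (End_alg k A) \<and>
    (\<forall>a\<in>carrier A. \<forall>b\<in>carrier A. D (a \<otimes>\<^bsub>A\<^esub> b) = a \<otimes>\<^bsub>A\<^esub> D b \<oplus>\<^bsub>A\<^esub> D a \<otimes>\<^bsub>A\<^esub> b)"
  by (auto simp: Der_def End_alg_def)

lemma Der_simps:
  "\<zero>\<^bsub>Der k A\<^esub> = (\<lambda>a\<in>carrier A. \<zero>\<^bsub>A\<^esub>)"
  "D \<oplus>\<^bsub>Der k A\<^esub> E = (\<lambda>a\<in>carrier A. D a \<oplus>\<^bsub>A\<^esub> E a)"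
  "c \<odot>\<^bsub>Der k A\<^esub> D = (\<lambda>a\<in>carrier A. c \<otimes>\<^bsub>A\<^esub> D a)"
  "bracket (Der k A) D E = (\<lambda>a\<in>carrier A. D (E a) \<ominus>\<^bsub>A\<^esub> E (D a))"
  by (simp_all add: Der_def)

lemma Der_closed: "\<lbrakk>D \<in> carrier (Der k A); a \<in> carrier A\<rbrakk> \<Longrightarrow> D a \<in> carrier A"
  by (auto simp: carrier_Der_iff End_alg_closed)

lemma Der_mult:
  "\<lbrakk>D \<in> carrier (Der k A); a \<in> carrier A; b \<in> carrier A\<rbrakk> \<Longrightarrow>
    D (a \<otimes>\<^bsub>A\<^esub> b) = a \<otimes>\<^bsub>A\<^esub> D b \<oplus>\<^bsub>A\<^esub> D a \<otimes>\<^bsub>A\<^esub> b"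
  by (simp add: carrier_Der_iff)

lemma Der_add:
  "\<lbrakk>D \<in> carrier (Der k A); a \<in> carrier A; b \<in> carrier A\<rbrakk> \<Longrightarrow>
    D (a \<oplus>\<^bsub>A\<^esub> b) = D a \<oplus>\<^bsub>A\<^esub> D b"
  by (auto simp: carrier_Der_iff carrier_End_alg_iff)

lemma Der_smult:
  "\<lbrakk>D \<in> carrier (Der k A); c \<in> carrier k; a \<in> carrier A\<rbrakk> \<Longrightarrow>
    D (c \<odot>\<^bsub>A\<^esub> a) = c \<odot>\<^bsub>A\<^esub> D a"
  by (auto simp: carrier_Der_iff carrier_End_alg_iff)

lemma restrict_lie_simps [simp]:
  "carrier (restrict_lie A L) = carrier L"
  "add (restrict_lie A L) = add L"
  "zero (restrict_lie A L) = zero L"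
  "bracket (restrict_lie A L) = bracket L"
  "smult (restrict_lie A L) = (\<lambda>c x. (c \<odot>\<^bsub>A\<^esub> \<one>\<^bsub>A\<^esub>) \<odot>\<^bsub>L\<^esub> x)"
  by (simp_all add: restrict_lie_def)

lemma restrict_scalars_simps [simp]:
  "carrier (restrict_scalars A M) = carrier M"
  "add (restrict_scalars A M) = add M"
  "zero (restrict_scalars A M) = zero M"
  "smult (restrict_scalars A M) = (\<lambda>c x. (c \<odot>\<^bsub>A\<^esub> \<one>\<^bsub>A\<^esub>) \<odot>\<^bsub>M\<^esub> x)"
  by (simp_all add: restrict_scalars_def)

context algebra
begin

text \<open>The factors are swapped on the right so that the result has the order in which
  \<open>m_comm[of a]\<close> leaves products in \<open>Der_module\<close>, where both rules are
  applied together.\<close>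

lemma smult_mult_left_commute:
  "\<lbrakk>c \<in> carrier R; x \<in> carrier M; y \<in> carrier M\<rbrakk> \<Longrightarrow>
    x \<otimes>\<^bsub>M\<^esub> (c \<odot>\<^bsub>M\<^esub> y) = c \<odot>\<^bsub>M\<^esub> (y \<otimes>\<^bsub>M\<^esub> x)"
  by (metis m_comm smult_assoc2 smult_closed)

text \<open>The Leibniz rule for 1 * 1 gives D 1 = D 1 + D 1, so D 1 vanishes, and k-linearity
  carries this to all scalars.\<close>

lemma Der_scalar:
  assumes D: "D \<in> carrier (Der R M)" and c: "c \<in> carrier R"
  shows "D (c \<odot>\<^bsub>M\<^esub> \<one>\<^bsub>M\<^esub>) = \<zero>\<^bsub>M\<^esub>"
proof -
  have D1: "D \<one>\<^bsub>M\<^esub> \<in> carrier M"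
    using Der_closed[OF D] by simp
  have "D \<one>\<^bsub>M\<^esub> = D \<one>\<^bsub>M\<^esub> \<oplus>\<^bsub>M\<^esub> D \<one>\<^bsub>M\<^esub>"
    using Der_mult[OF D, of "\<one>\<^bsub>M\<^esub>" "\<one>\<^bsub>M\<^esub>"] D1 by simp
  then have "D \<one>\<^bsub>M\<^esub> = \<zero>\<^bsub>M\<^esub>"
    using D1 by (metis M.add.r_cancel_one')
  then show ?thesis
    using c by (simp add: Der_smult[OF D])
qed

text \<open>Linearity of the bracket over the ground ring follows from the Leibniz rule, because
  derivations kill the scalars.\<close>

lemma lie_rinehartI:
  fixes L :: "('c, 'l, 'y) lie_rinehart_scheme"
  assumes L: "module M L"
    and closed: "\<And>X Y. \<lbrakk>X \<in> carrier L; Y \<in> carrier L\<rbrakk> \<Longrightarrow> bracket L X Y \<in> carrier L"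
    and add_left: "\<And>X Y Z. \<lbrakk>X \<in> carrier L; Y \<in> carrier L; Z \<in> carrier L\<rbrakk> \<Longrightarrow>
      bracket L (X \<oplus>\<^bsub>L\<^esub> Y) Z = bracket L X Z \<oplus>\<^bsub>L\<^esub> bracket L Y Z"
    and add_right: "\<And>X Y Z. \<lbrakk>X \<in> carrier L; Y \<in> carrier L; Z \<in> carrier L\<rbrakk> \<Longrightarrow>
      bracket L X (Y \<oplus>\<^bsub>L\<^esub> Z) = bracket L X Y \<oplus>\<^bsub>L\<^esub> bracket L X Z"
    and self: "\<And>X. X \<in> carrier L \<Longrightarrow> bracket L X X = \<zero>\<^bsub>L\<^esub>"
    and jacobi: "\<And>X Y Z. \<lbrakk>X \<in> carrier L; Y \<in> carrier L; Z \<in> carrier L\<rbrakk> \<Longrightarrow>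
      bracket L X (bracket L Y Z) \<oplus>\<^bsub>L\<^esub> bracket L Y (bracket L Z X)
        \<oplus>\<^bsub>L\<^esub> bracket L Z (bracket L X Y) = \<zero>\<^bsub>L\<^esub>"
    and anchor_Der: "\<And>X. X \<in> carrier L \<Longrightarrow> anchor L X \<in> carrier (Der R M)"
    and anchor_add: "\<And>X Y. \<lbrakk>X \<in> carrier L; Y \<in> carrier L\<rbrakk> \<Longrightarrow>
      anchor L (X \<oplus>\<^bsub>L\<^esub> Y) = anchor L X \<oplus>\<^bsub>Der R M\<^esub> anchor L Y"
    and anchor_smult: "\<And>a X. \<lbrakk>a \<in> carrier M; X \<in> carrier L\<rbrakk> \<Longrightarrow>
      anchor L (a \<odot>\<^bsub>L\<^esub> X) = a \<odot>\<^bsub>Der R M\<^esub> anchor L X"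
    and anchor_bracket: "\<And>X Y. \<lbrakk>X \<in> carrier L; Y \<in> carrier L\<rbrakk> \<Longrightarrow>
      anchor L (bracket L X Y) = bracket (Der R M) (anchor L X) (anchor L Y)"
    and leibniz: "\<And>a X Y. \<lbrakk>a \<in> carrier M; X \<in> carrier L; Y \<in> carrier L\<rbrakk> \<Longrightarrow>
      bracket L X (a \<odot>\<^bsub>L\<^esub> Y) = a \<odot>\<^bsub>L\<^esub> bracket L X Y \<oplus>\<^bsub>L\<^esub> anchor L X a \<odot>\<^bsub>L\<^esub> Y"
  shows "Defs.lie_rinehart R M L"
proof -
  interpret L: module M L by (rule L)
  have alg: "algebra R M" ..
  \<comment> \<open>Polarization of [X, X] = 0. The Leibniz rule speaks of the second argument only;
    antisymmetry moves its consequence to the first.\<close>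
  have antisym: "bracket L X Y = \<ominus>\<^bsub>L\<^esub> bracket L Y X" if "X \<in> carrier L" "Y \<in> carrier L" for X Y
  proof -
    have "bracket L X Y \<oplus>\<^bsub>L\<^esub> bracket L Y X = bracket L (X \<oplus>\<^bsub>L\<^esub> Y) (X \<oplus>\<^bsub>L\<^esub> Y)"
      using that by (simp add: add_left add_right closed self[of X] self[of Y] L.M.a_comm)
    also have "\<dots> = \<zero>\<^bsub>L\<^esub>"
      using that by (simp add: self)
    finally show ?thesis
      using that by (intro L.M.minus_equality[symmetric]) (simp_all add: closed)
  qed
  have smult_right: "bracket L X ((c \<odot>\<^bsub>M\<^esub> \<one>\<^bsub>M\<^esub>) \<odot>\<^bsub>L\<^esub> Y) = (c \<odot>\<^bsub>M\<^esub> \<one>\<^bsub>M\<^esub>) \<odot>\<^bsub>L\<^esub> bracket L X Y"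
    if "c \<in> carrier R" "X \<in> carrier L" "Y \<in> carrier L" for c X Y
    using that by (simp add: leibniz Der_scalar anchor_Der closed)
  have smult_left: "bracket L ((c \<odot>\<^bsub>M\<^esub> \<one>\<^bsub>M\<^esub>) \<odot>\<^bsub>L\<^esub> X) Y = (c \<odot>\<^bsub>M\<^esub> \<one>\<^bsub>M\<^esub>) \<odot>\<^bsub>L\<^esub> bracket L X Y"
    if "c \<in> carrier R" "X \<in> carrier L" "Y \<in> carrier L" for c X Y
    \<comment> \<open>With the second argument fixed to \<open>Y\<close>, the rewriting does not
      flip a bracket back again.\<close>
    using that by (simp add: antisym[of _ Y] smult_right closed L.smult_r_minus)
  have mod: "module R (restrict_lie M L)"
    by (rule module_cong[OF module_restrict_scalars[OF alg L]]) simp_all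
  have "Defs.lie_algebra R (restrict_lie M L)"
    using mod by (rule lie_algebra.intro, unfold_locales)
      (simp_all add: closed add_left add_right self jacobi smult_left smult_right)
  then show ?thesis
    using alg L
    by (intro lie_rinehart.intro)
      (auto simp: lie_hom_def lin_maps_def anchor_Der anchor_add anchor_smult anchor_bracket leibniz)
qed

end

section \<open>The axioms of a Lie-Rinehart algebra, stated without restriction of scalars\<close>

context lie_rinehart
begin

sublocale A: algebra k A by (rule base_algebra)
sublocale L: module A L by (rule module_over_base)

lemma bracket_closed: "\<lbrakk>X \<in> carrier L; Y \<in> carrier L\<rbrakk> \<Longrightarrow> bracket L X Y \<in> carrier L"
  using lie_algebra.bracket_closed[OF lie_algebra] by simp

lemma bracket_add_left:
  "\<lbrakk>X \<in> carrier L; Y \<in> carrier L; Z \<in> carrier L\<rbrakk> \<Longrightarrow>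
    bracket L (X \<oplus>\<^bsub>L\<^esub> Y) Z = bracket L X Z \<oplus>\<^bsub>L\<^esub> bracket L Y Z"
  using lie_algebra.bracket_add_left[OF lie_algebra] by simp

lemma bracket_add_right:
  "\<lbrakk>X \<in> carrier L; Y \<in> carrier L; Z \<in> carrier L\<rbrakk> \<Longrightarrow>
    bracket L X (Y \<oplus>\<^bsub>L\<^esub> Z) = bracket L X Y \<oplus>\<^bsub>L\<^esub> bracket L X Z"
  using lie_algebra.bracket_add_right[OF lie_algebra] by simp

lemma bracket_self: "X \<in> carrier L \<Longrightarrow> bracket L X X = \<zero>\<^bsub>L\<^esub>"
  using lie_algebra.bracket_self[OF lie_algebra] by simp

lemma jacobi:
  "\<lbrakk>X \<in> carrier L; Y \<in> carrier L; Z \<in> carrier L\<rbrakk> \<Longrightarrow>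
    bracket L X (bracket L Y Z) \<oplus>\<^bsub>L\<^esub> bracket L Y (bracket L Z X)
      \<oplus>\<^bsub>L\<^esub> bracket L Z (bracket L X Y) = \<zero>\<^bsub>L\<^esub>"
  using lie_algebra.jacobi[OF lie_algebra] by simp

lemma anchor_Der: "X \<in> carrier L \<Longrightarrow> anchor L X \<in> carrier (Der k A)"
  using anchor_lie_hom by (auto simp: lie_hom_def lin_maps_def)

lemma anchor_closed: "\<lbrakk>X \<in> carrier L; a \<in> carrier A\<rbrakk> \<Longrightarrow> anchor L X a \<in> carrier A"
  by (rule Der_closed[OF anchor_Der])

lemma anchor_add:
  "\<lbrakk>X \<in> carrier L; Y \<in> carrier L\<rbrakk> \<Longrightarrow> anchor L (X \<oplus>\<^bsub>L\<^esub> Y) = anchor L X \<oplus>\<^bsub>Der k A\<^esub> anchor L Y"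
  using anchor_lie_hom by (simp add: lie_hom_def lin_maps_def)

lemma anchor_bracket:
  "\<lbrakk>X \<in> carrier L; Y \<in> carrier L\<rbrakk> \<Longrightarrow>
    anchor L (bracket L X Y) = bracket (Der k A) (anchor L X) (anchor L Y)"
  using anchor_lie_hom by (simp add: lie_hom_def)

text \<open>Agreement of the actions is demanded on carriers only, because \<open>LR_End\<close> and
  the gauge algebra of the derivations agree only there.\<close>

lemma lie_rinehart_cong:
  fixes N :: "('a, 'l, 'z) lie_rinehart_scheme"
  assumes eq: "carrier N = carrier L" "\<zero>\<^bsub>N\<^esub> = \<zero>\<^bsub>L\<^esub>" "add N = add L"
      "bracket N = bracket L" "anchor N = anchor L"
    and smult_eq: "\<And>a X. \<lbrakk>a \<in> carrier A; X \<in> carrier L\<rbrakk> \<Longrightarrow> a \<odot>\<^bsub>N\<^esub> X = a \<odot>\<^bsub>L\<^esub> X"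
  shows "Defs.lie_rinehart k A N"
proof (rule A.lie_rinehartI)
  show "module A N"
    by (rule module_cong[OF module_over_base]) (simp_all add: eq smult_eq)
qed (simp_all add: eq smult_eq bracket_closed bracket_add_left bracket_add_right bracket_self
    jacobi anchor_Der anchor_add anchor_smult anchor_bracket leibniz anchor_closed)

end

section \<open>Derivations\<close>

text \<open>\<open>Der\<close> has no anchor field; adding the identity as anchor allows the
  derivations to take the place of L in \<open>DO\<close>.\<close>

definition Der_lie_rinehart ::
  "('k, 'r) ring_scheme \<Rightarrow> ('k, 'a, 'x) module_scheme \<Rightarrow> ('a, 'a \<Rightarrow> 'a) lie_rinehart" where
  "Der_lie_rinehart k A =
     \<lparr>carrier = carrier (Der k A), mult = undefined, one = undefined,
      zero = zero (Der k A), add = add (Der k A), smult = smult (Der k A),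
      bracket = bracket (Der k A), anchor = (\<lambda>D. D)\<rparr>"

context algebra
begin

text \<open>Both sides are extensional, the left by restriction and the right as an element of
  End_k(A), so comparing values on the carrier is enough.\<close>

lemma Der_bracket_eq_commutator:
  assumes "D \<in> carrier (Der R M)" "E \<in> carrier (Der R M)"
  shows "bracket (Der R M) D E = commutator (End_alg R M) D E"
proof -
  interpret E: ring "End_alg R M" by (rule End_alg_ring)
  have DE: "D \<in> carrier (End_alg R M)" "E \<in> carrier (End_alg R M)"
    using assms by (simp_all add: carrier_Der_iff)
  then have "commutator (End_alg R M) D E \<in> extensional (carrier M)"
    using E.commutator_closed by (simp add: carrier_End_alg_iff)
  then show ?thesis
    by (intro extensionalityI[of _ "carrier M"])
      (simp_all add: commutator_End_alg_apply DE Der_simps)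
qed

lemma Der_bracket_closed:
  assumes D: "D \<in> carrier (Der R M)" and E: "E \<in> carrier (Der R M)"
  shows "bracket (Der R M) D E \<in> carrier (Der R M)"
  unfolding carrier_Der_iff
proof (intro conjI ballI)
  interpret E: ring "End_alg R M" by (rule End_alg_ring)
  show "bracket (Der R M) D E \<in> carrier (End_alg R M)"
    using assms by (simp add: Der_bracket_eq_commutator E.commutator_closed carrier_Der_iff)
next
  fix a b assume ab: "a \<in> carrier M" "b \<in> carrier M"
  note cl = ab Der_closed[OF D] Der_closed[OF E]
  have "D (E (a \<otimes>\<^bsub>M\<^esub> b)) = (a \<otimes>\<^bsub>M\<^esub> D (E b) \<oplus>\<^bsub>M\<^esub> D a \<otimes>\<^bsub>M\<^esub> E b)
      \<oplus>\<^bsub>M\<^esub> (E a \<otimes>\<^bsub>M\<^esub> D b \<oplus>\<^bsub>M\<^esub> D (E a) \<otimes>\<^bsub>M\<^esub> b)"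
    using cl by (simp add: Der_mult[OF D] Der_mult[OF E] Der_add[OF D])
  moreover have "E (D (a \<otimes>\<^bsub>M\<^esub> b)) = (a \<otimes>\<^bsub>M\<^esub> E (D b) \<oplus>\<^bsub>M\<^esub> E a \<otimes>\<^bsub>M\<^esub> D b)
      \<oplus>\<^bsub>M\<^esub> (D a \<otimes>\<^bsub>M\<^esub> E b \<oplus>\<^bsub>M\<^esub> E (D a) \<otimes>\<^bsub>M\<^esub> b)"
    using cl by (simp add: Der_mult[OF D] Der_mult[OF E] Der_add[OF E])
  \<comment> \<open>The variables \<open>u\<close> and \<open>v\<close> stand for the mixed products
    D a * E b and E a * D b, which occur in both expansions and cancel.\<close>
  moreover have "((a \<otimes>\<^bsub>M\<^esub> x \<oplus>\<^bsub>M\<^esub> u) \<oplus>\<^bsub>M\<^esub> (v \<oplus>\<^bsub>M\<^esub> y \<otimes>\<^bsub>M\<^esub> b))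
      \<ominus>\<^bsub>M\<^esub> ((a \<otimes>\<^bsub>M\<^esub> z \<oplus>\<^bsub>M\<^esub> v) \<oplus>\<^bsub>M\<^esub> (u \<oplus>\<^bsub>M\<^esub> w \<otimes>\<^bsub>M\<^esub> b))
      = a \<otimes>\<^bsub>M\<^esub> (x \<ominus>\<^bsub>M\<^esub> z) \<oplus>\<^bsub>M\<^esub> (y \<ominus>\<^bsub>M\<^esub> w) \<otimes>\<^bsub>M\<^esub> b"
    if "x \<in> carrier M" "y \<in> carrier M" "z \<in> carrier M" "w \<in> carrier M"
      "u \<in> carrier M" "v \<in> carrier M" for x y z w u v
    using that ab by algebra
  ultimately show "bracket (Der R M) D E (a \<otimes>\<^bsub>M\<^esub> b)
      = a \<otimes>\<^bsub>M\<^esub> bracket (Der R M) D E b \<oplus>\<^bsub>M\<^esub> bracket (Der R M) D E a \<otimes>\<^bsub>M\<^esub> b"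
    using cl by (simp add: Der_simps)
qed

text \<open>Addition and zero are literally those of \<open>End_alg\<close>, so the group laws are
  inherited; the Leibniz rule has to be checked for sums, negatives, zero and multiples.\<close>

lemma Der_module: "module M (Der R M)"
proof (rule moduleI)
  interpret E: abelian_group "End_alg R M" by (rule End_alg_abelian_group)
  have sub: "D \<in> carrier (End_alg R M)" if "D \<in> carrier (Der R M)" for D
    using that by (simp add: carrier_Der_iff)
  have add_eq: "add (Der R M) = add (End_alg R M)" and zero_eq: "\<zero>\<^bsub>Der R M\<^esub> = \<zero>\<^bsub>End_alg R M\<^esub>"
    by (simp_all add: Der_def End_alg_def)
  show "cring M" by (rule M_cring)
  show "abelian_group (Der R M)"
  proof (rule abelian_groupI)
    fix D E assume DE: "D \<in> carrier (Der R M)" "E \<in> carrier (Der R M)"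
    show "D \<oplus>\<^bsub>Der R M\<^esub> E \<in> carrier (Der R M)"
      unfolding carrier_Der_iff
    proof (intro conjI ballI)
      show "D \<oplus>\<^bsub>Der R M\<^esub> E \<in> carrier (End_alg R M)"
        using DE by (simp add: add_eq sub)
      fix a b assume "a \<in> carrier M" "b \<in> carrier M"
      then show "(D \<oplus>\<^bsub>Der R M\<^esub> E) (a \<otimes>\<^bsub>M\<^esub> b)
          = a \<otimes>\<^bsub>M\<^esub> (D \<oplus>\<^bsub>Der R M\<^esub> E) b \<oplus>\<^bsub>M\<^esub> (D \<oplus>\<^bsub>Der R M\<^esub> E) a \<otimes>\<^bsub>M\<^esub> b"
        using DE
        by (simp add: Der_simps Der_mult Der_closed l_distr r_distr M.a_ac)
    qed
    have "(\<lambda>a\<in>carrier M. \<ominus>\<^bsub>M\<^esub> D a) \<in> carrier (Der R M)"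
      using DE End_alg_minus_closed[OF sub[OF DE(1)]] Der_closed[OF DE(1)]
      by (simp add: carrier_Der_iff[of _ R M] M.minus_add l_minus r_minus)
    then show "\<exists>E\<in>carrier (Der R M). E \<oplus>\<^bsub>Der R M\<^esub> D = \<zero>\<^bsub>Der R M\<^esub>"
      using DE by (rule_tac bexI) (auto simp: Der_simps Der_closed M.l_neg)
  next
    show "\<zero>\<^bsub>Der R M\<^esub> \<in> carrier (Der R M)"
      using E.zero_closed by (simp add: zero_eq carrier_Der_iff) (simp add: End_alg_simps)
  qed (auto simp: add_eq zero_eq sub E.a_ac)
next
  fix a D assume "a \<in> carrier M" "D \<in> carrier (Der R M)"
  then show "a \<odot>\<^bsub>Der R M\<^esub> D \<in> carrier (Der R M)"
    by (auto simp: carrier_Der_iff carrier_End_alg_iff Der_simps Pi_iff r_distr l_distr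
        m_comm[of a] m_assoc smult_assoc2 smult_mult_left_commute)
qed (auto simp: Der_simps Der_closed r_distr l_distr m_assoc,
    auto simp: carrier_Der_iff carrier_End_alg_iff Pi_iff intro!: extensionalityI[of _ "carrier M"])

lemma Der_lie_rinehart: "Defs.lie_rinehart R M (Der_lie_rinehart R M)"
proof -
  interpret E: ring "End_alg R M" by (rule End_alg_ring)
  interpret D: module M "Der R M" by (rule Der_module)
  have sub: "D \<in> carrier (End_alg R M)" if "D \<in> carrier (Der R M)" for D
    using that by (simp add: carrier_Der_iff)
  have add_eq: "add (Der R M) = add (End_alg R M)" and zero_eq: "\<zero>\<^bsub>Der R M\<^esub> = \<zero>\<^bsub>End_alg R M\<^esub>"
    by (simp_all add: Der_def End_alg_def)
  have comm: "bracket (Der R M) D E = commutator (End_alg R M) D E"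
    if "D \<in> carrier (Der R M)" "E \<in> carrier (Der R M)" for D E
    using that by (rule Der_bracket_eq_commutator)
  note cl = Der_bracket_closed D.a_closed
  show ?thesis
  proof (rule lie_rinehartI)
    show "module M (Der_lie_rinehart R M)"
      by (rule module_cong[OF Der_module]) (simp_all add: Der_lie_rinehart_def)
  next
    fix X Y Z
    assume "X \<in> carrier (Der_lie_rinehart R M)" "Y \<in> carrier (Der_lie_rinehart R M)"
      "Z \<in> carrier (Der_lie_rinehart R M)"
    then have XYZ: "X \<in> carrier (Der R M)" "Y \<in> carrier (Der R M)" "Z \<in> carrier (Der R M)"
      by (simp_all add: Der_lie_rinehart_def)
    have "bracket (Der R M) (X \<oplus>\<^bsub>Der R M\<^esub> Y) Z = bracket (Der R M) X Z \<oplus>\<^bsub>Der R M\<^esub> bracket (Der R M) Y Z"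
      \<comment> \<open>Two passes: passing to commutators requires the sum to be recognized as a
        derivation, which is done while it is still written with the addition of
        \<open>Der\<close>.\<close>
      using XYZ by (simp add: comm cl) (simp add: add_eq E.commutator_add_left sub)
    then show "bracket (Der_lie_rinehart R M) (X \<oplus>\<^bsub>Der_lie_rinehart R M\<^esub> Y) Z
      = bracket (Der_lie_rinehart R M) X Z \<oplus>\<^bsub>Der_lie_rinehart R M\<^esub> bracket (Der_lie_rinehart R M) Y Z"
      by (simp add: Der_lie_rinehart_def)
    have "bracket (Der R M) X (Y \<oplus>\<^bsub>Der R M\<^esub> Z) = bracket (Der R M) X Y \<oplus>\<^bsub>Der R M\<^esub> bracket (Der R M) X Z"
      using XYZ by (simp add: comm cl) (simp add: add_eq E.commutator_add_right sub)
    then show "bracket (Der_lie_rinehart R M) X (Y \<oplus>\<^bsub>Der_lie_rinehart R M\<^esub> Z)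
      = bracket (Der_lie_rinehart R M) X Y \<oplus>\<^bsub>Der_lie_rinehart R M\<^esub> bracket (Der_lie_rinehart R M) X Z"
      by (simp add: Der_lie_rinehart_def)
    show "bracket (Der_lie_rinehart R M) X X = \<zero>\<^bsub>Der_lie_rinehart R M\<^esub>"
      using XYZ by (simp add: Der_lie_rinehart_def comm zero_eq E.commutator_self sub)
    have "bracket (Der R M) X (bracket (Der R M) Y Z)
        \<oplus>\<^bsub>Der R M\<^esub> bracket (Der R M) Y (bracket (Der R M) Z X)
        \<oplus>\<^bsub>Der R M\<^esub> bracket (Der R M) Z (bracket (Der R M) X Y) = \<zero>\<^bsub>Der R M\<^esub>"
      \<comment> \<open>The outer brackets are rewritten first, while the inner ones are still
        visibly brackets in \<open>Der\<close> and hence known to be derivations.\<close>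
      using XYZ by (simp add: comm[of _ "bracket (Der R M) _ _"] cl)
        (simp add: comm add_eq zero_eq E.commutator_jacobi sub)
    then show "bracket (Der_lie_rinehart R M) X (bracket (Der_lie_rinehart R M) Y Z)
        \<oplus>\<^bsub>Der_lie_rinehart R M\<^esub> bracket (Der_lie_rinehart R M) Y (bracket (Der_lie_rinehart R M) Z X)
        \<oplus>\<^bsub>Der_lie_rinehart R M\<^esub> bracket (Der_lie_rinehart R M) Z (bracket (Der_lie_rinehart R M) X Y)
        = \<zero>\<^bsub>Der_lie_rinehart R M\<^esub>"
      by (simp add: Der_lie_rinehart_def)
  next
    fix a X Y
    assume "a \<in> carrier M" "X \<in> carrier (Der_lie_rinehart R M)" "Y \<in> carrier (Der_lie_rinehart R M)"
    then have aXY: "a \<in> carrier M" "X \<in> carrier (Der R M)" "Y \<in> carrier (Der R M)"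
      by (simp_all add: Der_lie_rinehart_def)
    \<comment> \<open>To be read at a point m with b = X a, x = X (Y m), y = Y m and z = Y (X m),
      after the Leibniz rule for X has been applied to a * Y m.\<close>
    have eq: "(a \<otimes>\<^bsub>M\<^esub> x \<oplus>\<^bsub>M\<^esub> b \<otimes>\<^bsub>M\<^esub> y) \<ominus>\<^bsub>M\<^esub> a \<otimes>\<^bsub>M\<^esub> z = a \<otimes>\<^bsub>M\<^esub> (x \<ominus>\<^bsub>M\<^esub> z) \<oplus>\<^bsub>M\<^esub> b \<otimes>\<^bsub>M\<^esub> y"
      if "b \<in> carrier M" "x \<in> carrier M" "y \<in> carrier M" "z \<in> carrier M" for b x y z
      using that aXY(1) by algebra
    show "bracket (Der_lie_rinehart R M) X (a \<odot>\<^bsub>Der_lie_rinehart R M\<^esub> Y)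
        = a \<odot>\<^bsub>Der_lie_rinehart R M\<^esub> bracket (Der_lie_rinehart R M) X Y
          \<oplus>\<^bsub>Der_lie_rinehart R M\<^esub> anchor (Der_lie_rinehart R M) X a \<odot>\<^bsub>Der_lie_rinehart R M\<^esub> Y"
      using aXY by (auto simp: Der_lie_rinehart_def Der_simps Der_mult Der_closed eq)
  qed (simp_all add: Der_lie_rinehart_def Der_bracket_closed)
qed

end

section \<open>Infinitesimal gauge transformations\<close>

lemma carrier_DO_iff:
  "(f, X) \<in> carrier (DO k A L M) \<longleftrightarrow>
    f \<in> carrier (End_alg k (restrict_scalars A M)) \<and> X \<in> carrier L \<and>
    (\<forall>a\<in>carrier A. \<forall>m\<in>carrier M. f (a \<odot>\<^bsub>M\<^esub> m) = anchor L X a \<odot>\<^bsub>M\<^esub> m \<oplus>\<^bsub>M\<^esub> a \<odot>\<^bsub>M\<^esub> f m)"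
  by (simp add: DO_def Let_def)

lemma DO_simps:
  "\<zero>\<^bsub>DO k A L M\<^esub> = (\<zero>\<^bsub>End_alg k (restrict_scalars A M)\<^esub>, \<zero>\<^bsub>L\<^esub>)"
  "(f, X) \<oplus>\<^bsub>DO k A L M\<^esub> (g, Y) = (f \<oplus>\<^bsub>End_alg k (restrict_scalars A M)\<^esub> g, X \<oplus>\<^bsub>L\<^esub> Y)"
  "a \<odot>\<^bsub>DO k A L M\<^esub> (f, X) = (\<lambda>m\<in>carrier M. a \<odot>\<^bsub>M\<^esub> f m, a \<odot>\<^bsub>L\<^esub> X)"
  "bracket (DO k A L M) (f, X) (g, Y)
    = (commutator (End_alg k (restrict_scalars A M)) f g, bracket L X Y)"
  "anchor (DO k A L M) (f, X) = anchor L X"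
  by (simp_all add: DO_def Let_def)

lemma DO_D:
  assumes "(f, X) \<in> carrier (DO k A L M)"
  shows "f \<in> carrier (End_alg k (restrict_scalars A M))" and "X \<in> carrier L"
    and "m \<in> carrier M \<Longrightarrow> f m \<in> carrier M"
    and "\<lbrakk>m \<in> carrier M; n \<in> carrier M\<rbrakk> \<Longrightarrow> f (m \<oplus>\<^bsub>M\<^esub> n) = f m \<oplus>\<^bsub>M\<^esub> f n"
    and "\<lbrakk>a \<in> carrier A; m \<in> carrier M\<rbrakk> \<Longrightarrow>
      f (a \<odot>\<^bsub>M\<^esub> m) = anchor L X a \<odot>\<^bsub>M\<^esub> m \<oplus>\<^bsub>M\<^esub> a \<odot>\<^bsub>M\<^esub> f m"
  using assms by (auto simp: carrier_DO_iff carrier_End_alg_iff)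

lemma DO_E:
  assumes "x \<in> carrier (DO k A L M)"
  obtains f X where "x = (f, X)" "f \<in> carrier (End_alg k (restrict_scalars A M))" "X \<in> carrier L"
    "\<And>m. m \<in> carrier M \<Longrightarrow> f m \<in> carrier M"
  using assms DO_D(1-3) by (metis surj_pair)

lemma DO_snd_closed: "x \<in> carrier (DO k A L M) \<Longrightarrow> snd x \<in> carrier L"
  by (auto elim: DO_E)

lemma DO_fst_closed:
  "\<lbrakk>x \<in> carrier (DO k A L M); m \<in> carrier M\<rbrakk> \<Longrightarrow> fst x m \<in> carrier M"
  by (auto elim: DO_E)

text \<open>Subtraction depends only on carrier, addition and zero, so the difference taken in
  \<open>restrict_scalars A M\<close> is the one taken in \<open>M\<close>.\<close>

lemma commutator_restrict_scalars_apply: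
  assumes A: "algebra k A" and M: "module A M"
    and f: "f \<in> carrier (End_alg k (restrict_scalars A M))"
    and g: "g \<in> carrier (End_alg k (restrict_scalars A M))" and m: "m \<in> carrier M"
  shows "commutator (End_alg k (restrict_scalars A M)) f g m = f (g m) \<ominus>\<^bsub>M\<^esub> g (f m)"
proof -
  interpret Mk: module k "restrict_scalars A M" by (rule module_restrict_scalars[OF A M])
  have "x \<ominus>\<^bsub>restrict_scalars A M\<^esub> y = x \<ominus>\<^bsub>M\<^esub> y" for x y
    by (simp add: a_minus_def a_inv_def m_inv_def)
  then show ?thesis
    using Mk.commutator_End_alg_apply[OF f g] m by simp
qed

context lie_rinehart
begin

text \<open>From f(b m) = omega(X)(b) m + b f(m), multiplication by a gives (a omega(X))(b) m + b (a
  f(m)), since A is commutative; and a omega(X) is the anchor of a X.\<close>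

lemma DO_smult_closed:
  assumes M: "module A M" and a: "a \<in> carrier A" and x: "(f, X) \<in> carrier (DO k A L M)"
  shows "((\<lambda>m\<in>carrier M. a \<odot>\<^bsub>M\<^esub> f m), a \<odot>\<^bsub>L\<^esub> X) \<in> carrier (DO k A L M)"
proof -
  interpret M: module A M by (rule M)
  note f = DO_D[OF x]
  have "(\<lambda>m\<in>carrier M. a \<odot>\<^bsub>M\<^esub> f m) \<in> carrier (End_alg k (restrict_scalars A M))"
    using a f(1) by (auto simp: carrier_End_alg_iff Pi_iff M.smult_r_distr M.smult_left_commute[of a])
  with a f(2-) show ?thesis
    by (simp add: carrier_DO_iff M.smult_r_distr M.smult_assoc1 anchor_smult Der_simps
        M.smult_left_commute[of a] anchor_closed)
qed

lemma DO_abelian_group: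
  assumes M: "module A M"
  shows "abelian_group (DO k A L M)"
proof -
  interpret M: module A M by (rule M)
  interpret Mk: module k "restrict_scalars A M" by (rule module_restrict_scalars[OF base_algebra M])
  interpret E: ring "End_alg k (restrict_scalars A M)" by (rule Mk.End_alg_ring)
  \<comment> \<open>Since 0 X = 0, A-linearity of the anchor makes the anchor of zero a zero
    multiple.\<close>
  have anchor_zero: "anchor L \<zero>\<^bsub>L\<^esub> a = \<zero>\<^bsub>A\<^esub>" if "a \<in> carrier A" for a
  proof -
    have "anchor L \<zero>\<^bsub>L\<^esub> a = (\<zero>\<^bsub>A\<^esub> \<odot>\<^bsub>Der k A\<^esub> anchor L \<zero>\<^bsub>L\<^esub>) a"
      using anchor_smult[of "\<zero>\<^bsub>A\<^esub>" "\<zero>\<^bsub>L\<^esub>"] by simp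
    then show ?thesis
      using that anchor_closed[of "\<zero>\<^bsub>L\<^esub>" a] by (simp add: Der_simps)
  qed
  show ?thesis
  proof (rule abelian_groupI)
    fix x y assume x_in: "x \<in> carrier (DO k A L M)" and y_in: "y \<in> carrier (DO k A L M)"
    obtain f X where "x = (f, X)" by (cases x)
    \<comment> \<open>\<open>f(1)\<close> is the splitting of the pair, so the facts of
      \<open>DO_D\<close> are shifted by one.\<close>
    note f = this DO_D[OF x_in[unfolded this]]
    obtain g Y where "y = (g, Y)" by (cases y)
    note g = this DO_D[OF y_in[unfolded this]]
    show "x \<oplus>\<^bsub>DO k A L M\<^esub> y \<in> carrier (DO k A L M)"
      using E.a_closed[OF f(2) g(2)] f(3-) g(3-)
      by (simp add: f(1) g(1) DO_simps carrier_DO_iff anchor_add)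
        (simp add: End_alg_simps Der_simps M.smult_r_distr M.smult_l_distr anchor_closed M.M.a_ac)
    show "x \<oplus>\<^bsub>DO k A L M\<^esub> y = y \<oplus>\<^bsub>DO k A L M\<^esub> x"
      using f g by (simp add: DO_simps E.a_comm L.M.a_comm)
    show "\<zero>\<^bsub>DO k A L M\<^esub> \<oplus>\<^bsub>DO k A L M\<^esub> x = x"
      using f by (simp add: DO_simps)
    \<comment> \<open>The additive inverse is taken as (-1)(f, X), whose membership is an instance
      of closure under the action.\<close>
    have minus: "((\<lambda>m\<in>carrier M. (\<ominus>\<^bsub>A\<^esub> \<one>\<^bsub>A\<^esub>) \<odot>\<^bsub>M\<^esub> f m), (\<ominus>\<^bsub>A\<^esub> \<one>\<^bsub>A\<^esub>) \<odot>\<^bsub>L\<^esub> X) \<in> carrier (DO k A L M)"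
      using x_in f by (intro DO_smult_closed[OF M]) simp_all
    show "\<exists>y\<in>carrier (DO k A L M). y \<oplus>\<^bsub>DO k A L M\<^esub> x = \<zero>\<^bsub>DO k A L M\<^esub>"
      using f by (intro bexI[OF _ minus])
        (auto simp: DO_simps End_alg_simps M.smult_l_minus L.smult_l_minus M.M.l_neg L.M.l_neg)
  next
    show "\<zero>\<^bsub>DO k A L M\<^esub> \<in> carrier (DO k A L M)"
      using E.zero_closed by (simp add: DO_simps carrier_DO_iff anchor_zero)
        (simp add: End_alg_simps)
  next
    fix x y z
    assume "x \<in> carrier (DO k A L M)" "y \<in> carrier (DO k A L M)" "z \<in> carrier (DO k A L M)"
    then show "x \<oplus>\<^bsub>DO k A L M\<^esub> y \<oplus>\<^bsub>DO k A L M\<^esub> z = x \<oplus>\<^bsub>DO k A L M\<^esub> (y \<oplus>\<^bsub>DO k A L M\<^esub> z)"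
      by (auto elim!: DO_E simp: DO_simps E.a_assoc L.M.a_assoc)
  qed
qed

lemma DO_module:
  assumes M: "module A M"
  shows "module A (DO k A L M)"
proof -
  interpret M: module A M by (rule M)
  show ?thesis
  proof (rule moduleI)
    show "cring A" by (rule A.M_cring)
    show "abelian_group (DO k A L M)" by (rule DO_abelian_group[OF M])
    show "a \<odot>\<^bsub>DO k A L M\<^esub> x \<in> carrier (DO k A L M)"
      if "a \<in> carrier A" "x \<in> carrier (DO k A L M)" for a x
      using that DO_smult_closed[OF M] by (cases x) (simp add: DO_simps)
    show "\<one>\<^bsub>A\<^esub> \<odot>\<^bsub>DO k A L M\<^esub> x = x" if "x \<in> carrier (DO k A L M)" for x
      using that by (auto elim!: DO_E simp: DO_simps carrier_End_alg_iff
          intro!: extensionalityI[of _ "carrier M"])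
  qed (auto elim!: DO_E simp: DO_simps End_alg_simps M.smult_l_distr M.smult_r_distr M.smult_assoc1
      L.smult_l_distr L.smult_r_distr L.smult_assoc1 intro!: ext)
qed

text \<open>After the mixed terms cancel, the coefficient of m is omega(X)(omega(Y)(a)) -
  omega(Y)(omega(X)(a)), the anchor of [X, Y] at a.\<close>

lemma DO_bracket_closed:
  assumes M: "module A M" and x_in: "x \<in> carrier (DO k A L M)" and y_in: "y \<in> carrier (DO k A L M)"
  shows "bracket (DO k A L M) x y \<in> carrier (DO k A L M)"
proof -
  interpret M: module A M by (rule M)
  interpret Mk: module k "restrict_scalars A M" by (rule module_restrict_scalars[OF base_algebra M])
  interpret E: ring "End_alg k (restrict_scalars A M)" by (rule Mk.End_alg_ring)
  obtain f X where "x = (f, X)" by (cases x)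
  note f = this DO_D[OF x_in[unfolded this]]
  obtain g Y where "y = (g, Y)" by (cases y)
  note g = this DO_D[OF y_in[unfolded this]]
  have comm: "commutator (End_alg k (restrict_scalars A M)) f g m = f (g m) \<ominus>\<^bsub>M\<^esub> g (f m)"
    if "m \<in> carrier M" for m
    using base_algebra M f(2) g(2) that by (rule commutator_restrict_scalars_apply)
  \<comment> \<open>Here u = omega(Y)(a) f(m) and v = omega(X)(a) g(m) are the mixed terms; p, r are
    the multiples of m, and q, s are a f(g(m)) and a g(f(m)).\<close>
  have cancel: "((p \<oplus>\<^bsub>M\<^esub> u) \<oplus>\<^bsub>M\<^esub> (v \<oplus>\<^bsub>M\<^esub> q)) \<ominus>\<^bsub>M\<^esub> ((r \<oplus>\<^bsub>M\<^esub> v) \<oplus>\<^bsub>M\<^esub> (u \<oplus>\<^bsub>M\<^esub> s))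
      = (p \<ominus>\<^bsub>M\<^esub> r) \<oplus>\<^bsub>M\<^esub> (q \<ominus>\<^bsub>M\<^esub> s)"
    if "p \<in> carrier M" "q \<in> carrier M" "r \<in> carrier M" "s \<in> carrier M" "u \<in> carrier M" "v \<in> carrier M"
    for p q r s u v
  proof -
    have "((p \<oplus>\<^bsub>M\<^esub> u) \<oplus>\<^bsub>M\<^esub> (v \<oplus>\<^bsub>M\<^esub> q)) \<ominus>\<^bsub>M\<^esub> ((r \<oplus>\<^bsub>M\<^esub> v) \<oplus>\<^bsub>M\<^esub> (u \<oplus>\<^bsub>M\<^esub> s))
        = ((p \<oplus>\<^bsub>M\<^esub> q) \<oplus>\<^bsub>M\<^esub> (u \<oplus>\<^bsub>M\<^esub> v)) \<ominus>\<^bsub>M\<^esub> ((r \<oplus>\<^bsub>M\<^esub> s) \<oplus>\<^bsub>M\<^esub> (u \<oplus>\<^bsub>M\<^esub> v))"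
      using that by (simp add: M.M.a_ac)
    also have "\<dots> = (p \<ominus>\<^bsub>M\<^esub> r) \<oplus>\<^bsub>M\<^esub> (q \<ominus>\<^bsub>M\<^esub> s)"
      using that by (simp add: M.M.minus_add_minus M.M.minus_self)
    finally show ?thesis .
  qed
  have "commutator (End_alg k (restrict_scalars A M)) f g (a \<odot>\<^bsub>M\<^esub> m)
      = anchor L (bracket L X Y) a \<odot>\<^bsub>M\<^esub> m
        \<oplus>\<^bsub>M\<^esub> a \<odot>\<^bsub>M\<^esub> commutator (End_alg k (restrict_scalars A M)) f g m"
    if "a \<in> carrier A" "m \<in> carrier M" for a m
    using that f(3-) g(3-)
    by (simp add: comm anchor_bracket Der_simps anchor_closed M.smult_l_diff M.smult_r_diff cancel)
  then show ?thesis
    using E.commutator_closed[OF f(2) g(2)] f(3) g(3)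
    by (simp add: f(1) g(1) DO_simps carrier_DO_iff bracket_closed)
qed

lemma DO_lie_rinehart:
  assumes M: "module A M"
  shows "Defs.lie_rinehart k A (DO k A L M)"
proof (rule A.lie_rinehartI)
  interpret M: module A M by (rule M)
  interpret Mk: module k "restrict_scalars A M" by (rule module_restrict_scalars[OF base_algebra M])
  interpret E: ring "End_alg k (restrict_scalars A M)" by (rule Mk.End_alg_ring)
  show "module A (DO k A L M)" by (rule DO_module[OF M])
  show "bracket (DO k A L M) x y \<in> carrier (DO k A L M)"
    if "x \<in> carrier (DO k A L M)" "y \<in> carrier (DO k A L M)" for x y
    using M that by (rule DO_bracket_closed)
  show "bracket (DO k A L M) x x = \<zero>\<^bsub>DO k A L M\<^esub>" if "x \<in> carrier (DO k A L M)" for x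
    using that by (auto elim!: DO_E simp: DO_simps E.commutator_self bracket_self)
  fix x y z
  assume xyz: "x \<in> carrier (DO k A L M)" "y \<in> carrier (DO k A L M)" "z \<in> carrier (DO k A L M)"
  then show "bracket (DO k A L M) (x \<oplus>\<^bsub>DO k A L M\<^esub> y) z
      = bracket (DO k A L M) x z \<oplus>\<^bsub>DO k A L M\<^esub> bracket (DO k A L M) y z"
    and "bracket (DO k A L M) x (y \<oplus>\<^bsub>DO k A L M\<^esub> z)
      = bracket (DO k A L M) x y \<oplus>\<^bsub>DO k A L M\<^esub> bracket (DO k A L M) x z"
    and "bracket (DO k A L M) x (bracket (DO k A L M) y z)
        \<oplus>\<^bsub>DO k A L M\<^esub> bracket (DO k A L M) y (bracket (DO k A L M) z x)
        \<oplus>\<^bsub>DO k A L M\<^esub> bracket (DO k A L M) z (bracket (DO k A L M) x y) = \<zero>\<^bsub>DO k A L M\<^esub>"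
    by (auto elim!: DO_E simp: DO_simps E.commutator_add_left E.commutator_add_right
        E.commutator_jacobi bracket_add_left bracket_add_right jacobi)
next
  interpret M: module A M by (rule M)
  interpret Mk: module k "restrict_scalars A M" by (rule module_restrict_scalars[OF base_algebra M])
  interpret E: ring "End_alg k (restrict_scalars A M)" by (rule Mk.End_alg_ring)
  fix a x y
  assume a: "a \<in> carrier A" and x_in: "x \<in> carrier (DO k A L M)" and y_in: "y \<in> carrier (DO k A L M)"
  obtain f X where "x = (f, X)" by (cases x)
  note f = this DO_D[OF x_in[unfolded this]]
  obtain g Y where "y = (g, Y)" by (cases y)
  note g = this DO_D[OF y_in[unfolded this]]
  let ?ag = "\<lambda>m\<in>carrier M. a \<odot>\<^bsub>M\<^esub> g m"
  have ag: "?ag \<in> carrier (End_alg k (restrict_scalars A M))"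
    using DO_smult_closed[OF M a y_in[unfolded g(1)]] by (simp add: carrier_DO_iff)
  \<comment> \<open>The Leibniz rule in the first component: the condition on f gives f(a g(m)) =
    omega(X)(a) g(m) + a f(g(m)). The second component is the Leibniz rule of L.\<close>
  have "commutator (End_alg k (restrict_scalars A M)) f ?ag
      = (\<lambda>m\<in>carrier M. a \<odot>\<^bsub>M\<^esub> commutator (End_alg k (restrict_scalars A M)) f g m
          \<oplus>\<^bsub>M\<^esub> anchor L X a \<odot>\<^bsub>M\<^esub> g m)" (is "_ = ?r")
  proof (rule extensionalityI[of _ "carrier M"])
    show "commutator (End_alg k (restrict_scalars A M)) f ?ag \<in> extensional (carrier M)"
      using E.commutator_closed[OF f(2) ag] by (simp add: carrier_End_alg_iff)
    show "commutator (End_alg k (restrict_scalars A M)) f ?ag m = ?r m" if "m \<in> carrier M" for m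
      using that a f(3-) g(3-) commutator_restrict_scalars_apply[OF base_algebra M f(2) ag that]
        commutator_restrict_scalars_apply[OF base_algebra M f(2) g(2) that]
      by (simp add: M.smult_r_distr M.smult_r_minus anchor_closed M.M.minus_eq M.M.a_ac)
  qed simp
  then show "bracket (DO k A L M) x (a \<odot>\<^bsub>DO k A L M\<^esub> y)
      = a \<odot>\<^bsub>DO k A L M\<^esub> bracket (DO k A L M) x y \<oplus>\<^bsub>DO k A L M\<^esub> anchor (DO k A L M) x a \<odot>\<^bsub>DO k A L M\<^esub> y"
    using a f g by (auto simp: DO_simps leibniz End_alg_simps)
qed (auto elim!: DO_E simp: DO_simps anchor_Der anchor_add anchor_smult anchor_bracket)

end

text \<open>k-linearity is not among the premises: scalars act through c 1_A, so it is a case of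
  A-linearity.\<close>

lemma lie_rinehart_homI:
  assumes A: "algebra k A" and "f \<in> extensional (carrier L)"
    and "\<And>X. X \<in> carrier L \<Longrightarrow> f X \<in> carrier N"
    and "\<And>X Y. \<lbrakk>X \<in> carrier L; Y \<in> carrier L\<rbrakk> \<Longrightarrow> f (X \<oplus>\<^bsub>L\<^esub> Y) = f X \<oplus>\<^bsub>N\<^esub> f Y"
    and "\<And>a X. \<lbrakk>a \<in> carrier A; X \<in> carrier L\<rbrakk> \<Longrightarrow> f (a \<odot>\<^bsub>L\<^esub> X) = a \<odot>\<^bsub>N\<^esub> f X"
    and "\<And>X Y. \<lbrakk>X \<in> carrier L; Y \<in> carrier L\<rbrakk> \<Longrightarrow> f (bracket L X Y) = bracket N (f X) (f Y)"
    and "\<And>X. X \<in> carrier L \<Longrightarrow> anchor N (f X) = anchor L X"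
  shows "f \<in> lie_rinehart_hom k A L N"
proof -
  interpret algebra k A by (rule A)
  show ?thesis
    using assms by (simp add: lie_rinehart_hom_def lie_hom_def lin_maps_def)
qed

lemma lie_rinehart_homD:
  assumes "f \<in> lie_rinehart_hom k A L N"
  shows "f \<in> extensional (carrier L)"
    and "X \<in> carrier L \<Longrightarrow> f X \<in> carrier N"
    and "\<lbrakk>X \<in> carrier L; Y \<in> carrier L\<rbrakk> \<Longrightarrow> f (X \<oplus>\<^bsub>L\<^esub> Y) = f X \<oplus>\<^bsub>N\<^esub> f Y"
    and "\<lbrakk>a \<in> carrier A; X \<in> carrier L\<rbrakk> \<Longrightarrow> f (a \<odot>\<^bsub>L\<^esub> X) = a \<odot>\<^bsub>N\<^esub> f X"
    and "\<lbrakk>X \<in> carrier L; Y \<in> carrier L\<rbrakk> \<Longrightarrow> f (bracket L X Y) = bracket N (f X) (f Y)"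
    and "X \<in> carrier L \<Longrightarrow> anchor N (f X) = anchor L X"
  using assms by (auto simp: lie_rinehart_hom_def lie_hom_def lin_maps_def)

section \<open>The product\<close>

abbreviation LR_End ::
  "('k, 'z) ring_scheme \<Rightarrow> ('k, 'a, 'x) module_scheme \<Rightarrow> ('a, 'm, 'w) module_scheme
    \<Rightarrow> ('a, ('m \<Rightarrow> 'm) \<times> ('a \<Rightarrow> 'a)) lie_rinehart" where
  "LR_End k A M \<equiv> LR_of_algebra k A (End_alg k (restrict_scalars A M)) (left_mult M)"

lemma LR_of_algebra_simps:
  "\<zero>\<^bsub>LR_of_algebra k A R \<phi>\<^esub> = (\<zero>\<^bsub>R\<^esub>, \<zero>\<^bsub>Der k A\<^esub>)"
  "(r, \<delta>) \<oplus>\<^bsub>LR_of_algebra k A R \<phi>\<^esub> (s, \<epsilon>) = (r \<oplus>\<^bsub>R\<^esub> s, \<delta> \<oplus>\<^bsub>Der k A\<^esub> \<epsilon>)"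
  "a \<odot>\<^bsub>LR_of_algebra k A R \<phi>\<^esub> (r, \<delta>) = (\<phi> a \<otimes>\<^bsub>R\<^esub> r, a \<odot>\<^bsub>Der k A\<^esub> \<delta>)"
  "bracket (LR_of_algebra k A R \<phi>) (r, \<delta>) (s, \<epsilon>) = (commutator R r s, bracket (Der k A) \<delta> \<epsilon>)"
  "anchor (LR_of_algebra k A R \<phi>) (r, \<delta>) = \<delta>"
  by (simp_all add: LR_of_algebra_def)

lemma left_mult_apply: "m \<in> carrier M \<Longrightarrow> left_mult M a m = a \<odot>\<^bsub>M\<^esub> m"
  by (simp add: left_mult_def)

lemma left_mult_End_alg:
  assumes A: "algebra k A" and M: "module A M" and a: "a \<in> carrier A"
  shows "left_mult M a \<in> carrier (End_alg k (restrict_scalars A M))"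
proof -
  interpret A: algebra k A by (rule A)
  interpret M: module A M by (rule M)
  show ?thesis
    using a by (auto simp: left_mult_def carrier_End_alg_iff M.smult_r_distr M.smult_left_commute[of a])
qed

text \<open>At m, the equation [f, l_a] = l_(delta a) reads f(a m) - a f(m) = delta(a) m: the
  condition of \<open>DO\<close> with delta in place of omega(X).\<close>

lemma carrier_LR_End_iff:
  assumes A: "algebra k A" and M: "module A M"
  shows "(f, \<delta>) \<in> carrier (LR_End k A M) \<longleftrightarrow>
    f \<in> carrier (End_alg k (restrict_scalars A M)) \<and> \<delta> \<in> carrier (Der k A) \<and>
    (\<forall>a\<in>carrier A. \<forall>m\<in>carrier M. f (a \<odot>\<^bsub>M\<^esub> m) = \<delta> a \<odot>\<^bsub>M\<^esub> m \<oplus>\<^bsub>M\<^esub> a \<odot>\<^bsub>M\<^esub> f m)"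
proof (cases "f \<in> carrier (End_alg k (restrict_scalars A M)) \<and> \<delta> \<in> carrier (Der k A)")
  case True
  then have f: "f \<in> carrier (End_alg k (restrict_scalars A M))" and \<delta>: "\<delta> \<in> carrier (Der k A)"
    by auto
  interpret A: algebra k A by (rule A)
  interpret M: module A M by (rule M)
  interpret Mk: module k "restrict_scalars A M" by (rule module_restrict_scalars[OF A M])
  interpret E: ring "End_alg k (restrict_scalars A M)" by (rule Mk.End_alg_ring)
  have "commutator (End_alg k (restrict_scalars A M)) f (left_mult M a) = left_mult M (\<delta> a) \<longleftrightarrow>
      (\<forall>m\<in>carrier M. f (a \<odot>\<^bsub>M\<^esub> m) = \<delta> a \<odot>\<^bsub>M\<^esub> m \<oplus>\<^bsub>M\<^esub> a \<odot>\<^bsub>M\<^esub> f m)" (is "?c = ?r \<longleftrightarrow> _")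
    if a: "a \<in> carrier A" for a
  proof -
    have la: "left_mult M a \<in> carrier (End_alg k (restrict_scalars A M))"
      using A M a by (rule left_mult_End_alg)
    have f_closed: "f m \<in> carrier M" if "m \<in> carrier M" for m
      using End_alg_closed[OF f] that by simp
    have "?c \<in> extensional (carrier M)" "?r \<in> extensional (carrier M)"
      using E.commutator_closed[OF f la] by (simp_all add: carrier_End_alg_iff left_mult_def)
    then have "?c = ?r \<longleftrightarrow> (\<forall>m\<in>carrier M. ?c m = ?r m)"
      by (auto intro: extensionalityI)
    also have "\<dots> \<longleftrightarrow> (\<forall>m\<in>carrier M. f (a \<odot>\<^bsub>M\<^esub> m) \<ominus>\<^bsub>M\<^esub> a \<odot>\<^bsub>M\<^esub> f m = \<delta> a \<odot>\<^bsub>M\<^esub> m)"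
      by (simp add: commutator_restrict_scalars_apply[OF A M f la] left_mult_apply f_closed)
    also have "\<dots> \<longleftrightarrow> (\<forall>m\<in>carrier M. f (a \<odot>\<^bsub>M\<^esub> m) = \<delta> a \<odot>\<^bsub>M\<^esub> m \<oplus>\<^bsub>M\<^esub> a \<odot>\<^bsub>M\<^esub> f m)"
      using a Der_closed[OF \<delta> a] f_closed
      by (intro ball_cong refl M.M.minus_eq_iff) simp_all
    finally show ?thesis .
  qed
  then show ?thesis
    using f \<delta> by (simp add: LR_of_algebra_def)
qed (auto simp: LR_of_algebra_def)

text \<open>Up to the values of the action outside the carrier, this Lie-Rinehart algebra is the
  gauge algebra of \<^term>\<open>M\<close> with respect to the Lie-Rinehart algebra of all derivations.\<close>

lemma LR_End_lie_rinehart: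
  assumes A: "algebra k A" and M: "module A M"
  shows "lie_rinehart k A (LR_End k A M)"
proof -
  interpret D: lie_rinehart k A "Der_lie_rinehart k A"
    using A by (rule algebra.Der_lie_rinehart)
  interpret DO: lie_rinehart k A "DO k A (Der_lie_rinehart k A) M"
    using M by (rule D.DO_lie_rinehart)
  show ?thesis
  proof (rule DO.lie_rinehart_cong)
    show "carrier (LR_End k A M) = carrier (DO k A (Der_lie_rinehart k A) M)"
      by (auto simp: carrier_LR_End_iff[OF A M] carrier_DO_iff Der_lie_rinehart_def)
    \<comment> \<open>One action composes with l_a, the other multiplies values by a; they agree
      because f maps the carrier of M into itself, where l_a is not a default value.\<close>
    show "a \<odot>\<^bsub>LR_End k A M\<^esub> x = a \<odot>\<^bsub>DO k A (Der_lie_rinehart k A) M\<^esub> x"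
      if "a \<in> carrier A" "x \<in> carrier (DO k A (Der_lie_rinehart k A) M)" for a x
      using that by (auto elim!: DO_E simp: LR_of_algebra_simps DO_simps Der_lie_rinehart_def
          End_alg_simps compose_def left_mult_def intro!: restrict_ext)
  qed (simp_all add: LR_of_algebra_def DO_def Let_def Der_lie_rinehart_def)
qed

section \<open>The two projections\<close>

lemma DO_proj_L_apply: "(f, X) \<in> carrier (DO k A L M) \<Longrightarrow> DO_proj_L k A L M (f, X) = X"
  by (simp add: DO_proj_L_def)

lemma DO_proj_End_apply:
  "(f, X) \<in> carrier (DO k A L M) \<Longrightarrow> DO_proj_End k A L M (f, X) = (f, anchor L X)"
  by (simp add: DO_proj_End_def)

context lie_rinehart
begin

lemma DO_proj_L_hom:
  assumes M: "module A M"
  shows "DO_proj_L k A L M \<in> lie_rinehart_hom k A (DO k A L M) L"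
proof (rule lie_rinehart_homI[OF base_algebra])
  interpret D: lie_rinehart k A "DO k A L M" using M by (rule DO_lie_rinehart)
  show "DO_proj_L k A L M (x \<oplus>\<^bsub>DO k A L M\<^esub> y) = DO_proj_L k A L M x \<oplus>\<^bsub>L\<^esub> DO_proj_L k A L M y"
    and "DO_proj_L k A L M (bracket (DO k A L M) x y)
      = bracket L (DO_proj_L k A L M x) (DO_proj_L k A L M y)"
    if "x \<in> carrier (DO k A L M)" "y \<in> carrier (DO k A L M)" for x y
    \<comment> \<open>The projections are restricted functions and can be evaluated at sums and
      brackets only once these are known to lie in \<open>DO\<close>.\<close>
    using that D.L.M.a_closed[OF that] D.bracket_closed[OF that]
    by (cases x; cases y; simp add: DO_simps DO_proj_L_apply)+
  show "DO_proj_L k A L M (a \<odot>\<^bsub>DO k A L M\<^esub> x) = a \<odot>\<^bsub>L\<^esub> DO_proj_L k A L M x"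
    if "a \<in> carrier A" "x \<in> carrier (DO k A L M)" for a x
    using that D.L.smult_closed[OF that] by (cases x) (simp add: DO_simps DO_proj_L_apply)
  show "DO_proj_L k A L M x \<in> carrier L" "anchor L (DO_proj_L k A L M x) = anchor (DO k A L M) x"
    if "x \<in> carrier (DO k A L M)" for x
    using that DO_snd_closed[OF that] by (cases x; simp add: DO_proj_L_apply DO_simps)+
qed (simp add: DO_proj_L_def)

text \<open>The coordinate omega(X) is compatible with all operations because the anchor is;
  membership in the target is \<open>carrier_LR_End_iff\<close> at delta = omega(X).\<close>

lemma DO_proj_End_hom:
  assumes M: "module A M"
  shows "DO_proj_End k A L M \<in> lie_rinehart_hom k A (DO k A L M) (LR_End k A M)"
proof (rule lie_rinehart_homI[OF base_algebra])
  interpret D: lie_rinehart k A "DO k A L M" using M by (rule DO_lie_rinehart)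
  show "DO_proj_End k A L M (x \<oplus>\<^bsub>DO k A L M\<^esub> y)
      = DO_proj_End k A L M x \<oplus>\<^bsub>LR_End k A M\<^esub> DO_proj_End k A L M y"
    and "DO_proj_End k A L M (bracket (DO k A L M) x y)
      = bracket (LR_End k A M) (DO_proj_End k A L M x) (DO_proj_End k A L M y)"
    if "x \<in> carrier (DO k A L M)" "y \<in> carrier (DO k A L M)" for x y
    using that D.L.M.a_closed[OF that] D.bracket_closed[OF that]
      DO_snd_closed[OF that(1)] DO_snd_closed[OF that(2)]
    by (cases x; cases y; simp add: DO_simps DO_proj_End_apply LR_of_algebra_simps
        anchor_add anchor_bracket)+
  show "DO_proj_End k A L M (a \<odot>\<^bsub>DO k A L M\<^esub> x) = a \<odot>\<^bsub>LR_End k A M\<^esub> DO_proj_End k A L M x"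
    if "a \<in> carrier A" "x \<in> carrier (DO k A L M)" for a x
    using that D.L.smult_closed[OF that] DO_snd_closed[OF that(2)] DO_fst_closed[OF that(2)]
    by (cases x) (auto simp: DO_simps DO_proj_End_apply LR_of_algebra_simps anchor_smult
        End_alg_simps compose_def left_mult_def)
  show "DO_proj_End k A L M x \<in> carrier (LR_End k A M)" if "x \<in> carrier (DO k A L M)" for x
    using that
    by (cases x) (auto simp: DO_proj_End_apply carrier_LR_End_iff[OF base_algebra M]
        carrier_DO_iff[of _ _ k A L M] anchor_Der)
  show "anchor (LR_End k A M) (DO_proj_End k A L M x) = anchor (DO k A L M) x"
    if "x \<in> carrier (DO k A L M)" for x
    using that by (cases x) (simp add: DO_proj_End_apply DO_simps LR_of_algebra_simps)
qed (simp add: DO_proj_End_def)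

section \<open>The universal property\<close>

lemma DO_universal:
  fixes N :: "('a, 'n, 'u) lie_rinehart_scheme"
  assumes M: "module A M" and N: "Defs.lie_rinehart k A N"
    and f: "f \<in> lie_rinehart_hom k A N L" and g: "g \<in> lie_rinehart_hom k A N (LR_End k A M)"
  shows "\<exists>!h. h \<in> lie_rinehart_hom k A N (DO k A L M) \<and>
    compose (carrier N) (DO_proj_L k A L M) h = f \<and> compose (carrier N) (DO_proj_End k A L M) h = g"
proof (rule ex1I)
  interpret N: module A N by (rule lie_rinehart.module_over_base[OF N])
  let ?h = "\<lambda>X\<in>carrier N. (fst (g X), f X)"
  note fD = lie_rinehart_homD[OF f] and gD = lie_rinehart_homD[OF g]
  \<comment> \<open>The anchor of \<open>LR_End\<close> is its second coordinate. As f and g both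
    preserve anchors, this coordinate of g X is the anchor of X in N, which is also that of f
    X.\<close>
  have g_eq: "g X = (fst (g X), anchor L (f X))" if "X \<in> carrier N" for X
    using gD(6)[OF that] fD(6)[OF that] by (cases "g X") (simp add: LR_of_algebra_simps)
  have h_closed: "(fst (g X), f X) \<in> carrier (DO k A L M)" if "X \<in> carrier N" for X
    using gD(2)[OF that] fD(2)[OF that] g_eq[OF that]
    by (metis carrier_DO_iff carrier_LR_End_iff[OF base_algebra M])
  have g_add: "fst (g (X \<oplus>\<^bsub>N\<^esub> Y)) = fst (g X) \<oplus>\<^bsub>End_alg k (restrict_scalars A M)\<^esub> fst (g Y)"
    and g_bracket: "fst (g (bracket N X Y))
      = commutator (End_alg k (restrict_scalars A M)) (fst (g X)) (fst (g Y))"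
    if "X \<in> carrier N" "Y \<in> carrier N" for X Y
    using that gD(3,5)[of X Y] by (cases "g X"; cases "g Y"; simp add: LR_of_algebra_simps)+
  have g_smult: "fst (g (a \<odot>\<^bsub>N\<^esub> X)) = (\<lambda>m\<in>carrier M. a \<odot>\<^bsub>M\<^esub> fst (g X) m)"
    if "a \<in> carrier A" "X \<in> carrier N" for a X
  proof -
    \<comment> \<open>Needed to evaluate l_a at this value, since \<open>LR_End\<close> acts by
      composition with l_a.\<close>
    have "fst (g X) m \<in> carrier M" if "m \<in> carrier M" for m
      using DO_fst_closed[OF h_closed[OF \<open>X \<in> carrier N\<close>] that] by simp
    then show ?thesis
      using that gD(4)[OF that]
      by (cases "g X") (auto simp: LR_of_algebra_simps End_alg_simps compose_def left_mult_def)
  qed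
  have "?h \<in> lie_rinehart_hom k A N (DO k A L M)"
    by (rule lie_rinehart_homI[OF base_algebra])
      (simp_all add: h_closed DO_simps g_add g_bracket g_smult fD lie_rinehart.bracket_closed[OF N])
  moreover have "compose (carrier N) (DO_proj_L k A L M) ?h = f"
    using fD(1) by (intro extensionalityI[of _ "carrier N"])
      (simp_all add: compose_def DO_proj_L_apply h_closed)
  moreover have "compose (carrier N) (DO_proj_End k A L M) ?h = g"
    using gD(1) by (intro extensionalityI[of _ "carrier N"])
      (simp_all add: compose_def DO_proj_End_apply h_closed g_eq[symmetric])
  ultimately show "?h \<in> lie_rinehart_hom k A N (DO k A L M) \<and>
    compose (carrier N) (DO_proj_L k A L M) ?h = f \<and> compose (carrier N) (DO_proj_End k A L M) ?h = g"
    by blast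
  fix h
  assume h: "h \<in> lie_rinehart_hom k A N (DO k A L M) \<and>
    compose (carrier N) (DO_proj_L k A L M) h = f \<and> compose (carrier N) (DO_proj_End k A L M) h = g"
  show "h = ?h"
  proof (rule extensionalityI[of _ "carrier N"])
    show "h \<in> extensional (carrier N)"
      using h by (auto intro: lie_rinehart_homD(1))
    fix X assume X: "X \<in> carrier N"
    have "h X \<in> carrier (DO k A L M)"
      using h by (intro lie_rinehart_homD(2)[OF _ X]) (rule conjunct1)
    \<comment> \<open>Uniqueness: the first projection reads off the L-coordinate of h X, and the
      second exposes its endomorphism as first coordinate.\<close>
    moreover have "f X = DO_proj_L k A L M (h X)" "g X = DO_proj_End k A L M (h X)"
      using h X by (auto simp: compose_def)
    ultimately show "h X = ?h X"
      using X by (cases "h X") (simp add: DO_proj_L_apply DO_proj_End_apply)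
  qed simp
qed

end

theorem proposition4p7:
  fixes k :: "'k ring" and A :: "('k, 'a) module"
    and M :: "('a, 'm) module" and L :: "('a, 'l) lie_rinehart"
  assumes "field k" and "char_zero k"
    and "algebra k A"
    and "module A M"
    and "lie_rinehart k A L"
  shows "is_LieRin_product TYPE('n) k A (DO k A L M) (DO_proj_L k A L M) (DO_proj_End k A L M)
           L (LR_of_algebra k A (End_alg k (restrict_scalars A M)) (left_mult M))"
proof -
  interpret lie_rinehart k A L by (rule assms)
  show ?thesis
    unfolding is_LieRin_product_def
  proof (intro conjI allI impI)
    show "lie_rinehart k A (DO k A L M)"
      using assms(4) by (rule DO_lie_rinehart)
    show "lie_rinehart k A L" by (rule assms)
    show "lie_rinehart k A (LR_End k A M)"
      using assms(3,4) by (rule LR_End_lie_rinehart)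
    show "DO_proj_L k A L M \<in> lie_rinehart_hom k A (DO k A L M) L"
      using assms(4) by (rule DO_proj_L_hom)
    show "DO_proj_End k A L M \<in> lie_rinehart_hom k A (DO k A L M) (LR_End k A M)"
      using assms(4) by (rule DO_proj_End_hom)
  qed (rule DO_universal[OF assms(4)])
qed

end
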